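(* Let $(\mathcal M,\omega,\mathscr H)$ be a Hamiltonian system with initial value $\gamma_0\in\mathcal M$, let $\check{\mathcal M}$ be a smooth manifold, let $\varphi\in C^\infty(\check{\mathcal M},\mathcal M)$ be a smooth embedding such that $\check\omega:=\varphi^*\omega$ is nondegenerate, and let $\varrho\in C^\infty(\mathcal M,\check{\mathcal M})$ be a point reduction for $\varphi$. Then the SMG-ROM is a Hamiltonian system $(\check{\mathcal M},\check\omega,\check{\mathscr H})$ with the reduced Hamiltonian $\check{\mathscr H}:=\varphi^*\mathscr H=\mathscr H\circ\varphi$.
   Context: A symplectic form on a smooth manifold $\mathcal M$ is a smooth $(0,2)$-tensor field $\omega$ that is skew-symmetric, nondegenerate (invertible coordinate matrix at each point) and closed; $(\mathcal M,\omega)$ is then a symplectic manifold. For a nondegenerate $(0,2)$-tensor field $\tau$, $\flat_\tau:T_m\mathcal M\to T^*_m\mathcal M$ is given by $(\flat_\tau v)_i=\sum_j(\tau|_m)_{ij}v^j$ and $\sharp_\tau$ is its inverse. A Hamiltonian system $(\mathcal M,\omega,\mathscr H)$ consists of a symplectic manifold $(\mathcal M,\omega)$ and a function $\mathscr H\in C^\infty(\mathcal M,\mathbb R)$, together with the initial value problem $\frac{\mathrm d}{\mathrm dt}\gamma|_t=X_{\mathscr H}|_{\gamma(t)}$, $\gamma(t_0)=\gamma_0\in\mathcal M$, where the Hamiltonian vector field is $X_{\mathscr H}:=\sharp_\omega(\mathrm d\mathscr H)$. A smooth embedding is a smooth immersion that is a homeomorphism onto its image; a point reduction for $\varphi$ is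 a map $\varrho\in C^\infty(\mathcal M,\check{\mathcal M})$ with $\varrho\circ\varphi=\mathrm{id}_{\check{\mathcal M}}$. Pullback of tensor fields: $(\varphi^*\omega)|_{\check m}(\check v,\check w)=\omega|_{\varphi(\check m)}(\mathrm d\varphi|_{\check m}\check v,\mathrm d\varphi|_{\check m}\check w)$. The pointwise pullback of covectors is $\mathrm d\varphi^*|_{\check m}:T^*_{\varphi(\check m)}\mathcal M\to T^*_{\check m}\check{\mathcal M}$, $\lambda\mapsto\lambda\circ\mathrm d\varphi|_{\check m}$. The symplectic manifold Galerkin (SMG) reduction map is, for $m\in\varphi(\check{\mathcal M})$ and $v\in T_m\mathcal M$, $$R_{\mathrm{SMG}}(m,v)=\big(\varrho(m),R_{\mathrm{SMG}}|_m(v)\big),\qquad R_{\mathrm{SMG}}|_m(v)=\big(\sharp_{\check\omega}\circ\mathrm d\varphi^*|_{\varrho(m)}\circ\flat_\omega\big)(v).$$ The SMG-ROM is the initial value problem on $\check{\mathcal M}$ $$\tfrac{\mathrm d}{\mathrm dt}\check\gamma\big|_t=R_{\mathrm{SMG}}|_{\varphi(\check\gamma(t))}\big(X_{\mathscr H}|_{\varphi(\check\gamma(t))}\big),\qquad\check\gamma(t_0)=\varrho(\gamma_0).$$ *)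

theory Defs
  imports "HOL-Analysis.Analysis"
begin

section \<open>Smooth maps between open sets of normed spaces\<close>

text \<open>On an open set of a finite-dimensional space, being \<open>C\<^sup>k\<^sup>+\<^sup>1\<close> means being differentiable with
  all directional derivatives \<open>C\<^sup>k\<close>. The predicates are only meant for open sets.\<close>

primrec Ck_on :: "nat \<Rightarrow> 'a::real_normed_vector set \<Rightarrow> ('a \<Rightarrow> 'b::real_normed_vector) \<Rightarrow> bool" where
  "Ck_on 0 U f \<longleftrightarrow> continuous_on U f"
| "Ck_on (Suc k) U f \<longleftrightarrow>
     (\<forall>x\<in>U. f differentiable (at x)) \<and> (\<forall>v. Ck_on k U (\<lambda>x. frechet_derivative f (at x) v))"

definition smooth_on :: "'a::real_normed_vector set \<Rightarrow> ('a \<Rightarrow> 'b::real_normed_vector) \<Rightarrow> bool" where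
  "smooth_on U f \<longleftrightarrow> (\<forall>k. Ck_on k U f)"


section \<open>Smooth manifolds\<close>

type_synonym ('p, 'n) chart = "'p set \<times> ('p \<Rightarrow> real ^ 'n)"

text \<open>The dimension of the manifold is \<open>CARD('n)\<close>. Values of a chart outside its domain are
  irrelevant. The atlas need not be maximal: the notions below that quantify over the
  charts of an atlas depend only on the smooth structure it generates.\<close>

record ('p, 'n) manifold =
  mtop :: "'p topology"
  atlas :: "('p, 'n) chart set"

abbreviation points :: "('p, 'n::finite) manifold \<Rightarrow> 'p set" where
  "points M \<equiv> topspace (mtop M)"

abbreviation cdom :: "('p, 'n::finite) chart \<Rightarrow> 'p set" where
  "cdom c \<equiv> fst c"

abbreviation coord :: "('p, 'n::finite) chart \<Rightarrow> 'p \<Rightarrow> real ^ 'n" where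
  "coord c \<equiv> snd c"

definition param :: "('p, 'n::finite) chart \<Rightarrow> real ^ 'n \<Rightarrow> 'p" where
  "param c = inv_into (cdom c) (coord c)"

definition charts_at :: "('p, 'n::finite) manifold \<Rightarrow> 'p \<Rightarrow> ('p, 'n) chart set" where
  "charts_at M p = {c \<in> atlas M. p \<in> cdom c}"

definition topological_chart :: "'p topology \<Rightarrow> ('p, 'n::finite) chart \<Rightarrow> bool" where
  "topological_chart X c \<longleftrightarrow>
     openin X (cdom c) \<and> open (coord c ` cdom c) \<and>
     homeomorphic_map (subtopology X (cdom c)) (top_of_set (coord c ` cdom c)) (coord c)"

definition smooth_manifold :: "('p, 'n::finite) manifold \<Rightarrow> bool" where
  "smooth_manifold M \<longleftrightarrow>
     Hausdorff_space (mtop M) \<and> second_countable (mtop M) \<and>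
     (\<forall>c\<in>atlas M. topological_chart (mtop M) c) \<and>
     (\<Union>c\<in>atlas M. cdom c) = points M \<and>
     (\<forall>c\<in>atlas M. \<forall>d\<in>atlas M. smooth_on (coord c ` (cdom c \<inter> cdom d)) (coord d \<circ> param c))"

definition smooth_map ::
  "('p, 'm::finite) manifold \<Rightarrow> ('q, 'n::finite) manifold \<Rightarrow> ('p \<Rightarrow> 'q) \<Rightarrow> bool" where
  "smooth_map M N f \<longleftrightarrow>
     continuous_map (mtop M) (mtop N) f \<and>
     (\<forall>c\<in>atlas M. \<forall>d\<in>atlas N.
        smooth_on (coord c ` (cdom c \<inter> f -` cdom d)) (coord d \<circ> f \<circ> param c))"

definition smooth_function :: "('p, 'm::finite) manifold \<Rightarrow> ('p \<Rightarrow> real) \<Rightarrow> bool" where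
  "smooth_function M h \<longleftrightarrow> (\<forall>c\<in>atlas M. smooth_on (coord c ` cdom c) (h \<circ> param c))"


section \<open>Tangent and cotangent spaces, differentials\<close>

text \<open>A tangent vector at \<open>p\<close> is a family of coordinate vectors, one for every chart around
  \<open>p\<close>, transforming by the derivatives of the chart transitions (and 0 at the charts not
  containing \<open>p\<close>, to make the representation unique). The vector space operations are
  chartwise.\<close>

type_synonym ('p, 'n) tvec = "('p, 'n) chart \<Rightarrow> real ^ 'n"

type_synonym ('p, 'n) covec = "('p, 'n) tvec \<Rightarrow> real"

definition tadd :: "('p, 'n::finite) tvec \<Rightarrow> ('p, 'n) tvec \<Rightarrow> ('p, 'n) tvec" where
  "tadd v w = (\<lambda>c. v c + w c)"

definition tscale :: "real \<Rightarrow> ('p, 'n::finite) tvec \<Rightarrow> ('p, 'n) tvec" where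
  "tscale a v = (\<lambda>c. a *\<^sub>R v c)"

definition tangent_space :: "('p, 'n::finite) manifold \<Rightarrow> 'p \<Rightarrow> ('p, 'n) tvec set" where
  "tangent_space M p =
     {v. (\<forall>c\<in>charts_at M p. \<forall>d\<in>charts_at M p.
            v d = frechet_derivative (coord d \<circ> param c) (at (coord c p)) (v c)) \<and>
         (\<forall>c. c \<notin> charts_at M p \<longrightarrow> v c = 0)}"

text \<open>The coordinate vector \<open>\<partial>/\<partial>x\<^sup>i\<close> at \<open>p\<close> of the chart \<open>c = (U, x)\<close>.\<close>

definition coord_vec :: "('p, 'n::finite) manifold \<Rightarrow> ('p, 'n) chart \<Rightarrow> 'n \<Rightarrow> 'p \<Rightarrow> ('p, 'n) tvec" where
  "coord_vec M c i p =
     (\<lambda>d. if d \<in> charts_at M p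
          then frechet_derivative (coord d \<circ> param c) (at (coord c p)) (axis i 1) else 0)"

definition tlinear :: "('p, 'n::finite) manifold \<Rightarrow> 'p \<Rightarrow> (('p, 'n) tvec \<Rightarrow> real) \<Rightarrow> bool" where
  "tlinear M p l \<longleftrightarrow>
     (\<forall>v\<in>tangent_space M p. \<forall>w\<in>tangent_space M p. l (tadd v w) = l v + l w) \<and>
     (\<forall>a. \<forall>v\<in>tangent_space M p. l (tscale a v) = a * l v)"

definition cotangent_space :: "('p, 'n::finite) manifold \<Rightarrow> 'p \<Rightarrow> ('p, 'n) covec set" where
  "cotangent_space M p = {l. tlinear M p l} \<inter> extensional (tangent_space M p)"

definition differential ::
  "('p, 'm::finite) manifold \<Rightarrow> ('q, 'n::finite) manifold \<Rightarrow> ('p \<Rightarrow> 'q) \<Rightarrow> 'p \<Rightarrow>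
   ('p, 'm) tvec \<Rightarrow> ('q, 'n) tvec" where
  "differential M N f p v =
     (THE w. w \<in> tangent_space N (f p) \<and>
        (\<forall>c\<in>charts_at M p. \<forall>d\<in>charts_at N (f p).
           w d = frechet_derivative (coord d \<circ> f \<circ> param c) (at (coord c p)) (v c)))"

definition dfun :: "('p, 'm::finite) manifold \<Rightarrow> ('p \<Rightarrow> real) \<Rightarrow> 'p \<Rightarrow> ('p, 'm) covec" where
  "dfun M h p =
     (THE l. l \<in> cotangent_space M p \<and>
        (\<forall>c\<in>charts_at M p. \<forall>v\<in>tangent_space M p.
           l v = frechet_derivative (h \<circ> param c) (at (coord c p)) (v c)))"

definition covec_pullback ::
  "('p, 'm::finite) manifold \<Rightarrow> ('q, 'n::finite) manifold \<Rightarrow> ('p \<Rightarrow> 'q) \<Rightarrow> 'p \<Rightarrow>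
   ('q, 'n) covec \<Rightarrow> ('p, 'm) covec" where
  "covec_pullback M N f p l = restrict (l \<circ> differential M N f p) (tangent_space M p)"

definition smooth_embedding ::
  "('p, 'm::finite) manifold \<Rightarrow> ('q, 'n::finite) manifold \<Rightarrow> ('p \<Rightarrow> 'q) \<Rightarrow> bool" where
  "smooth_embedding M N f \<longleftrightarrow>
     smooth_map M N f \<and>
     (\<forall>p\<in>points M. inj_on (differential M N f p) (tangent_space M p)) \<and>
     embedding_map (mtop M) (mtop N) f"

definition point_reduction ::
  "('p, 'm::finite) manifold \<Rightarrow> ('q, 'n::finite) manifold \<Rightarrow> ('q \<Rightarrow> 'p) \<Rightarrow> ('p \<Rightarrow> 'q) \<Rightarrow> bool" where
  "point_reduction M N \<phi> \<rho> \<longleftrightarrow> smooth_map M N \<rho> \<and> (\<forall>q\<in>points N. \<rho> (\<phi> q) = q)"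


section \<open>Tensor fields of type (0,2) and symplectic forms\<close>

type_synonym ('p, 'n) tensor02 = "'p \<Rightarrow> ('p, 'n) tvec \<Rightarrow> ('p, 'n) tvec \<Rightarrow> real"

definition tensor_field02 :: "('p, 'n::finite) manifold \<Rightarrow> ('p, 'n) tensor02 \<Rightarrow> bool" where
  "tensor_field02 M \<tau> \<longleftrightarrow>
     (\<forall>p\<in>points M. \<forall>v\<in>tangent_space M p. tlinear M p (\<tau> p v) \<and> tlinear M p (\<lambda>w. \<tau> p w v))"

definition tcoeff ::
  "('p, 'n::finite) manifold \<Rightarrow> ('p, 'n) tensor02 \<Rightarrow> ('p, 'n) chart \<Rightarrow> 'n \<Rightarrow> 'n \<Rightarrow> 'p \<Rightarrow> real" where
  "tcoeff M \<tau> c i j p = \<tau> p (coord_vec M c i p) (coord_vec M c j p)"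

definition smooth_tensor :: "('p, 'n::finite) manifold \<Rightarrow> ('p, 'n) tensor02 \<Rightarrow> bool" where
  "smooth_tensor M \<tau> \<longleftrightarrow>
     (\<forall>c\<in>atlas M. \<forall>i j. smooth_on (coord c ` cdom c) (tcoeff M \<tau> c i j \<circ> param c))"

definition skew_tensor :: "('p, 'n::finite) manifold \<Rightarrow> ('p, 'n) tensor02 \<Rightarrow> bool" where
  "skew_tensor M \<tau> \<longleftrightarrow>
     (\<forall>p\<in>points M. \<forall>v\<in>tangent_space M p. \<forall>w\<in>tangent_space M p. \<tau> p v w = - \<tau> p w v)"

definition nondegenerate :: "('p, 'n::finite) manifold \<Rightarrow> ('p, 'n) tensor02 \<Rightarrow> bool" where
  "nondegenerate M \<tau> \<longleftrightarrow>
     (\<forall>p\<in>points M. \<forall>c\<in>charts_at M p. invertible ((\<chi> i j. tcoeff M \<tau> c i j p) :: real ^ 'n ^ 'n))"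

text \<open>\<open>\<partial>\<tau>\<^sub>i\<^sub>j/\<partial>x\<^sup>k\<close> at \<open>p\<close>, in the chart \<open>c\<close>.\<close>

definition dcoeff ::
  "('p, 'n::finite) manifold \<Rightarrow> ('p, 'n) tensor02 \<Rightarrow> ('p, 'n) chart \<Rightarrow> 'n \<Rightarrow> 'n \<Rightarrow> 'n \<Rightarrow> 'p \<Rightarrow> real" where
  "dcoeff M \<tau> c k i j p =
     frechet_derivative (tcoeff M \<tau> c i j \<circ> param c) (at (coord c p)) (axis k 1)"

text \<open>For a 2-form, the left-hand side below is the \<open>(i, j, k)\<close> component of the exterior
  derivative.\<close>

definition closed_tensor :: "('p, 'n::finite) manifold \<Rightarrow> ('p, 'n) tensor02 \<Rightarrow> bool" where
  "closed_tensor M \<tau> \<longleftrightarrow>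
     (\<forall>p\<in>points M. \<forall>c\<in>charts_at M p. \<forall>i j k.
        dcoeff M \<tau> c i j k p + dcoeff M \<tau> c j k i p + dcoeff M \<tau> c k i j p = 0)"

definition symplectic_form :: "('p, 'n::finite) manifold \<Rightarrow> ('p, 'n) tensor02 \<Rightarrow> bool" where
  "symplectic_form M \<omega> \<longleftrightarrow>
     tensor_field02 M \<omega> \<and> smooth_tensor M \<omega> \<and> skew_tensor M \<omega> \<and> nondegenerate M \<omega> \<and>
     closed_tensor M \<omega>"

definition symplectic_manifold :: "('p, 'n::finite) manifold \<Rightarrow> ('p, 'n) tensor02 \<Rightarrow> bool" where
  "symplectic_manifold M \<omega> \<longleftrightarrow> smooth_manifold M \<and> symplectic_form M \<omega>"

definition tensor_pullback ::
  "('q, 'n::finite) manifold \<Rightarrow> ('p, 'm::finite) manifold \<Rightarrow> ('q \<Rightarrow> 'p) \<Rightarrow>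
   ('p, 'm) tensor02 \<Rightarrow> ('q, 'n) tensor02" where
  "tensor_pullback N M \<phi> \<omega> =
     (\<lambda>q v w. \<omega> (\<phi> q) (differential N M \<phi> q v) (differential N M \<phi> q w))"

text \<open>\<open>flat M \<tau> p v\<close> is the covector with components \<open>(flat v)\<^sub>i = \<Sum>\<^sub>j \<tau>\<^sub>i\<^sub>j v\<^sup>j\<close> in every chart. Note
  the order of the indices: the vector \<open>v\<close> fills the second slot of \<open>\<tau>\<close>.\<close>

definition flat ::
  "('p, 'n::finite) manifold \<Rightarrow> ('p, 'n) tensor02 \<Rightarrow> 'p \<Rightarrow> ('p, 'n) tvec \<Rightarrow> ('p, 'n) covec" where
  "flat M \<tau> p v =
     (THE l. l \<in> cotangent_space M p \<and>
        (\<forall>c\<in>charts_at M p. \<forall>i. l (coord_vec M c i p) = (\<Sum>j\<in>UNIV. tcoeff M \<tau> c i j p * v c $ j)))"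

definition sharp ::
  "('p, 'n::finite) manifold \<Rightarrow> ('p, 'n) tensor02 \<Rightarrow> 'p \<Rightarrow> ('p, 'n) covec \<Rightarrow> ('p, 'n) tvec" where
  "sharp M \<tau> p = inv_into (tangent_space M p) (flat M \<tau> p)"


section \<open>Hamiltonian systems\<close>

definition hamiltonian_system ::
  "('p, 'n::finite) manifold \<Rightarrow> ('p, 'n) tensor02 \<Rightarrow> ('p \<Rightarrow> real) \<Rightarrow> bool" where
  "hamiltonian_system M \<omega> H \<longleftrightarrow> symplectic_manifold M \<omega> \<and> smooth_function M H"

definition hamiltonian_vf ::
  "('p, 'n::finite) manifold \<Rightarrow> ('p, 'n) tensor02 \<Rightarrow> ('p \<Rightarrow> real) \<Rightarrow> 'p \<Rightarrow> ('p, 'n) tvec" where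
  "hamiltonian_vf M \<omega> H p = sharp M \<omega> p (dfun M H p)"

text \<open>\<open>has_velocity M \<gamma> v t I\<close>: the curve \<open>\<gamma>\<close> on \<open>I\<close> has the velocity \<open>v\<close> at time \<open>t\<close>
  (one-sided if \<open>t\<close> is an endpoint of \<open>I\<close>). For continuous \<open>\<gamma>\<close>, the curve stays near \<open>t\<close> in the
  domain of each chart around \<open>\<gamma> t\<close>.\<close>

definition has_velocity ::
  "('p, 'n::finite) manifold \<Rightarrow> (real \<Rightarrow> 'p) \<Rightarrow> ('p, 'n) tvec \<Rightarrow> real \<Rightarrow> real set \<Rightarrow> bool" where
  "has_velocity M \<gamma> v t I \<longleftrightarrow>
     v \<in> tangent_space M (\<gamma> t) \<and>
     (\<forall>c\<in>charts_at M (\<gamma> t). ((coord c \<circ> \<gamma>) has_vector_derivative v c) (at t within I))"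

definition solves_ivp ::
  "('p, 'n::finite) manifold \<Rightarrow> ('p \<Rightarrow> ('p, 'n) tvec) \<Rightarrow> real \<Rightarrow> 'p \<Rightarrow> real set \<Rightarrow> (real \<Rightarrow> 'p) \<Rightarrow> bool" where
  "solves_ivp M X t0 p0 I \<gamma> \<longleftrightarrow>
     is_interval I \<and> interior I \<noteq> {} \<and> t0 \<in> I \<and>
     continuous_map (top_of_set I) (mtop M) \<gamma> \<and>
     (\<forall>t\<in>I. has_velocity M \<gamma> (X (\<gamma> t)) t I) \<and>
     \<gamma> t0 = p0"

definition hamiltonian_ivp ::
  "('p, 'n::finite) manifold \<Rightarrow> ('p, 'n) tensor02 \<Rightarrow> ('p \<Rightarrow> real) \<Rightarrow>
   real \<Rightarrow> 'p \<Rightarrow> real set \<Rightarrow> (real \<Rightarrow> 'p) \<Rightarrow> bool" where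
  "hamiltonian_ivp M \<omega> H t0 p0 I \<gamma> \<longleftrightarrow> solves_ivp M (hamiltonian_vf M \<omega> H) t0 p0 I \<gamma>"


section \<open>Symplectic manifold Galerkin reduction\<close>

definition smg_reduction_at ::
  "('p, 'm::finite) manifold \<Rightarrow> ('p, 'm) tensor02 \<Rightarrow> ('q, 'n::finite) manifold \<Rightarrow>
   ('q \<Rightarrow> 'p) \<Rightarrow> ('p \<Rightarrow> 'q) \<Rightarrow> 'p \<Rightarrow> ('p, 'm) tvec \<Rightarrow> ('q, 'n) tvec" where
  "smg_reduction_at M \<omega> N \<phi> \<rho> m =
     sharp N (tensor_pullback N M \<phi> \<omega>) (\<rho> m) \<circ> covec_pullback N M \<phi> (\<rho> m) \<circ> flat M \<omega> m"

text \<open>The reduction map on pairs \<open>(m, v)\<close> with \<open>m\<close> in the image of \<open>\<phi>\<close> and \<open>v\<close> tangent at \<open>m\<close>.\<close>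

definition smg_reduction ::
  "('p, 'm::finite) manifold \<Rightarrow> ('p, 'm) tensor02 \<Rightarrow> ('q, 'n::finite) manifold \<Rightarrow>
   ('q \<Rightarrow> 'p) \<Rightarrow> ('p \<Rightarrow> 'q) \<Rightarrow> 'p \<times> ('p, 'm) tvec \<Rightarrow> 'q \<times> ('q, 'n) tvec" where
  "smg_reduction M \<omega> N \<phi> \<rho> = (\<lambda>(m, v). (\<rho> m, smg_reduction_at M \<omega> N \<phi> \<rho> m v))"

definition smg_vf ::
  "('p, 'm::finite) manifold \<Rightarrow> ('p, 'm) tensor02 \<Rightarrow> ('p \<Rightarrow> real) \<Rightarrow> ('q, 'n::finite) manifold \<Rightarrow>
   ('q \<Rightarrow> 'p) \<Rightarrow> ('p \<Rightarrow> 'q) \<Rightarrow> 'q \<Rightarrow> ('q, 'n) tvec" where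
  "smg_vf M \<omega> H N \<phi> \<rho> q = snd (smg_reduction M \<omega> N \<phi> \<rho> (\<phi> q, hamiltonian_vf M \<omega> H (\<phi> q)))"

definition smg_rom ::
  "('p, 'm::finite) manifold \<Rightarrow> ('p, 'm) tensor02 \<Rightarrow> ('p \<Rightarrow> real) \<Rightarrow> ('q, 'n::finite) manifold \<Rightarrow>
   ('q \<Rightarrow> 'p) \<Rightarrow> ('p \<Rightarrow> 'q) \<Rightarrow> real \<Rightarrow> 'p \<Rightarrow> real set \<Rightarrow> (real \<Rightarrow> 'q) \<Rightarrow> bool" where
  "smg_rom M \<omega> H N \<phi> \<rho> t0 \<gamma>0 I \<gamma> \<longleftrightarrow> solves_ivp N (smg_vf M \<omega> H N \<phi> \<rho>) t0 (\<rho> \<gamma>0) I \<gamma>"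

end

theory Submission
  imports Defs
begin

text \<open>
  Write \<open>d\<phi>\<^sup>*\<close> for the pullback of covectors and \<open>\<omega>'\<close> for \<open>\<phi>\<^sup>*\<omega>\<close>. The reduced vector field at \<open>q\<close> is
  the \<open>\<omega>'\<close>-sharp of \<open>d\<phi>\<^sup>*(flat(X\<^sub>H))\<close>, evaluated at the base point \<open>\<rho>(\<phi>(q)) = q\<close>. Since \<open>X\<^sub>H\<close> is the
  sharp of \<open>dH\<close>, flat and sharp cancel, and by the chain rule \<open>d\<phi>\<^sup>*(dH) = d(H \<circ> \<phi>)\<close>. What remains is
  the \<open>\<omega>'\<close>-sharp of \<open>d(H \<circ> \<phi>)\<close>, the Hamiltonian vector field of the reduced Hamiltonian
  (\<open>flat_sharp\<close>, \<open>covec_pullback_dfun\<close>, \<open>covec_pullback_flat_hamiltonian_vf\<close>). The two initial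
  value problems therefore have the same right-hand side on \<open>N\<close> and the same solutions.

  That \<open>\<omega>'\<close> is symplectic needs an argument in coordinates. In charts, \<open>\<phi>\<close> is a smooth map \<open>F\<close>
  between open sets, and the coefficients of \<open>\<omega>'\<close> are sums of products of coefficients of \<open>\<omega>\<close> at
  \<open>F\<close> with first derivatives of \<open>F\<close> (\<open>tcoeff_pullback\<close>). Smoothness follows from closure of smooth
  functions under composition and products. For closedness (\<open>closed_pullback_coeff\<close>), the cyclic sum
  of their derivatives splits into the exterior derivative of \<open>\<omega>\<close>, which vanishes, and terms with
  second derivatives of \<open>F\<close>, which cancel by skewness and symmetry of second derivatives
  (\<open>frechet_derivative_commute_vec\<close>). Nondegeneracy is assumed.

  Tangent vectors are families of coordinate vectors, and differentials, covectors and musical maps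
  are given by definite descriptions. Their existence and chart independence all come from the chain
  rule for local representatives (\<open>local_deriv_compose\<close>), where a coordinate change is the local
  representative of the identity.
\<close>

section \<open>Calculus of smooth maps on open sets\<close>

lemma Ck_on_cong:
  assumes "open U" "\<And>x. x \<in> U \<Longrightarrow> f x = g x" "Ck_on k U f"
  shows "Ck_on k U g"
  using assms(2,3)
proof (induction k arbitrary: f g)
  case 0
  then show ?case by (auto cong: continuous_on_cong)
next
  case (Suc k)
  have D: "(g has_derivative frechet_derivative f (at x)) (at x)" if "x \<in> U" for x
    using has_derivative_transform_within_open[OF _ \<open>open U\<close> that, of f _ UNIV g] Suc.prems that
    by (auto simp: frechet_derivative_works)
  then have "frechet_derivative g (at x) = frechet_derivative f (at x)" if "x \<in> U" for x
    using frechet_derivative_at that by metis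
  with Suc.IH[of "\<lambda>x. frechet_derivative f (at x) v" "\<lambda>x. frechet_derivative g (at x) v" for v]
  show ?case using Suc.prems differentiableI[OF D] by simp
qed

text \<open>Chart representatives of a global object are only defined on small overlaps, so smoothness on
  a chart domain is established near one point at a time.\<close>

lemma Ck_on_local:
  assumes "\<And>x. x \<in> U \<Longrightarrow> \<exists>V. open V \<and> x \<in> V \<and> Ck_on k V f"
  shows "Ck_on k U f"
  using assms
proof (induction k arbitrary: f)
  case 0
  have "isCont f x" if "x \<in> U" for x
    using 0[OF that] continuous_on_eq_continuous_at by (metis Ck_on.simps(1))
  then show ?case by (simp add: continuous_at_imp_continuous_on)
next
  case (Suc k)
  have "f differentiable (at x)" if "x \<in> U" for x
    using Suc.prems[OF that] by auto
  moreover have "Ck_on k U (\<lambda>x. frechet_derivative f (at x) v)" for v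
    using Suc.prems by (intro Suc.IH) (simp, blast)
  ultimately show ?case by simp
qed

lemma Ck_on_subset:
  assumes "open U" "V \<subseteq> U" "Ck_on k U f"
  shows "Ck_on k V f"
  using assms by (intro Ck_on_local) auto

text \<open>The product rule multiplies a derivative of one factor, which is only \<open>C\<^sup>k\<close>, by the other
  factor itself. Lowering the order of the latter is what makes inductions on \<open>k\<close> go through.\<close>

lemma Ck_on_SucD:
  assumes "Ck_on (Suc k) U f"
  shows "Ck_on k U f"
  using assms
proof (induction k arbitrary: f)
  case 0
  then show ?case
    by (simp add: continuous_at_imp_continuous_on differentiable_imp_continuous_within)
next
  case (Suc k)
  then show ?case by simp
qed

lemma Ck_on_const: "Ck_on k U (\<lambda>x. a)"
proof (induction k arbitrary: a)
  case (Suc k)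
  then show ?case by (simp add: Suc)
qed simp

lemma Ck_on_add:
  assumes "open U" "Ck_on k U f" "Ck_on k U g"
  shows "Ck_on k U (\<lambda>x. f x + g x)"
  using assms(2,3)
proof (induction k arbitrary: f g)
  case 0
  then show ?case by (simp add: continuous_on_add)
next
  case (Suc k)
  have D: "((\<lambda>x. f x + g x) has_derivative
      (\<lambda>v. frechet_derivative f (at x) v + frechet_derivative g (at x) v)) (at x)" if "x \<in> U" for x
    using Suc.prems that by (intro derivative_intros) (auto simp: frechet_derivative_works)
  have "Ck_on k U (\<lambda>x. frechet_derivative (\<lambda>x. f x + g x) (at x) v)" for v
    by (rule Ck_on_cong[OF assms(1) _ Suc.IH[of "\<lambda>x. frechet_derivative f (at x) v"
          "\<lambda>x. frechet_derivative g (at x) v"]])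
       (use Suc.prems in \<open>auto simp: frechet_derivative_at[OF D, symmetric]\<close>)
  then show ?case using differentiableI[OF D] by simp
qed

lemma Ck_on_sum:
  assumes "open U" "\<And>i. i \<in> I \<Longrightarrow> Ck_on k U (f i)"
  shows "Ck_on k U (\<lambda>x. \<Sum>i\<in>I. f i x)"
  using assms by (induction I rule: infinite_finite_induct) (auto intro: Ck_on_const Ck_on_add)

lemma Ck_on_bounded_linear:
  assumes "bounded_linear L" "open U" "Ck_on k U f"
  shows "Ck_on k U (\<lambda>x. L (f x))"
  using assms(3)
proof (induction k arbitrary: f)
  case 0
  then show ?case using assms(1) by (auto intro: bounded_linear.continuous_on)
next
  case (Suc k)
  have D: "((\<lambda>x. L (f x)) has_derivative (\<lambda>v. L (frechet_derivative f (at x) v))) (at x)"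
    if "x \<in> U" for x
    using Suc.prems that
    by (intro bounded_linear.has_derivative[OF assms(1)]) (auto simp: frechet_derivative_works)
  have "Ck_on k U (\<lambda>x. frechet_derivative (\<lambda>x. L (f x)) (at x) v)" for v
    by (rule Ck_on_cong[OF assms(2) _ Suc.IH[of "\<lambda>x. frechet_derivative f (at x) v"]])
       (use Suc.prems in \<open>auto simp: frechet_derivative_at[OF D, symmetric]\<close>)
  then show ?case using differentiableI[OF D] by simp
qed

lemma Ck_on_bounded_bilinear:
  assumes "bounded_bilinear B" "open U" "Ck_on k U f" "Ck_on k U g"
  shows "Ck_on k U (\<lambda>x. B (f x) (g x))"
  using assms(3,4)
proof (induction k arbitrary: f g)
  case 0
  then show ?case using assms(1) by (auto intro: bounded_bilinear.continuous_on)
next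
  case (Suc k)
  have D: "((\<lambda>x. B (f x) (g x)) has_derivative
      (\<lambda>v. B (f x) (frechet_derivative g (at x) v) + B (frechet_derivative f (at x) v) (g x))) (at x)"
    if "x \<in> U" for x
    using Suc.prems that
    by (intro bounded_bilinear.FDERIV[OF assms(1)]) (auto simp: frechet_derivative_works)
  have "Ck_on k U (\<lambda>x. frechet_derivative (\<lambda>x. B (f x) (g x)) (at x) v)" for v
    by (rule Ck_on_cong[OF assms(2) _ Ck_on_add[OF assms(2)
          Suc.IH[of f "\<lambda>x. frechet_derivative g (at x) v"]
          Suc.IH[of "\<lambda>x. frechet_derivative f (at x) v" g]]])
       (use Suc.prems Ck_on_SucD[of k U f] Ck_on_SucD[of k U g] in \<open>auto simp: frechet_derivative_at[OF D, symmetric]\<close>)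
  then show ?case using differentiableI[OF D] by simp
qed

lemma linear_euclidean_expansion:
  fixes L :: "'a::euclidean_space \<Rightarrow> 'b::real_vector"
  assumes "linear L"
  shows "L u = (\<Sum>b\<in>Basis. (u \<bullet> b) *\<^sub>R L b)"
proof -
  have "L (\<Sum>b\<in>Basis. (u \<bullet> b) *\<^sub>R b) = (\<Sum>b\<in>Basis. (u \<bullet> b) *\<^sub>R L b)"
    by (simp add: linear_sum[OF assms] linear_scale[OF assms])
  then show ?thesis by (simp add: euclidean_representation)
qed

text \<open>Expanding the inner derivative in a basis turns the chain rule into a finite sum of products
  of a partial derivative of \<open>g\<close>, composed with \<open>f\<close>, and a component of a derivative of \<open>f\<close>. The
  induction hypothesis applies to the former, one order lower.\<close>

lemma Ck_on_compose:
  fixes f :: "'a::real_normed_vector \<Rightarrow> 'b::euclidean_space"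
    and g :: "'b \<Rightarrow> 'c::real_normed_vector"
  assumes "open U" "f ` U \<subseteq> V" "Ck_on k U f" "Ck_on k V g"
  shows "Ck_on k U (g \<circ> f)"
  using assms(3,4)
proof (induction k arbitrary: g)
  case 0
  then have "continuous_on (f ` U) g" by (simp add: continuous_on_subset[OF _ assms(2)])
  with 0 show ?case by (simp only: Ck_on.simps continuous_on_compose)
next
  case (Suc k)
  have df: "f differentiable (at x)" and dg: "g differentiable (at (f x))" if "x \<in> U" for x
    using Suc.prems assms(2) that by auto
  have D: "frechet_derivative (g \<circ> f) (at x) v =
      (\<Sum>b\<in>Basis. (frechet_derivative f (at x) v \<bullet> b) *\<^sub>R frechet_derivative g (at (f x)) b)"
    if "x \<in> U" for x v
    unfolding frechet_derivative_compose[OF df[OF that] dg[OF that]] o_apply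
    by (rule linear_euclidean_expansion[OF linear_frechet_derivative[OF dg[OF that]]])
  have P: "Ck_on k U (\<lambda>x. (frechet_derivative f (at x) v \<bullet> b) *\<^sub>R
      ((\<lambda>y. frechet_derivative g (at y) b) \<circ> f) x)" for v b
    using Suc.prems Ck_on_SucD[of k U f]
    by (intro Ck_on_bounded_bilinear[OF bounded_bilinear_scaleR] assms Suc.IH
        Ck_on_bounded_linear[OF bounded_linear_inner_left]) auto
  have "Ck_on k U (\<lambda>x. frechet_derivative (g \<circ> f) (at x) v)" for v
    by (rule Ck_on_cong[OF assms(1) _ Ck_on_sum[OF assms(1) P]]) (simp only: D o_apply)
  moreover have "(g \<circ> f) differentiable (at x)" if "x \<in> U" for x
    using df dg that by (simp add: differentiable_chain_at)
  ultimately show ?case by (simp only: Ck_on.simps) blast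
qed

lemma smooth_on_cong:
  "\<lbrakk>open U; \<And>x. x \<in> U \<Longrightarrow> f x = g x; smooth_on U f\<rbrakk> \<Longrightarrow> smooth_on U g"
  unfolding smooth_on_def using Ck_on_cong by blast

lemma smooth_on_local:
  "(\<And>x. x \<in> U \<Longrightarrow> \<exists>V. open V \<and> x \<in> V \<and> smooth_on V f) \<Longrightarrow> smooth_on U f"
  unfolding smooth_on_def by (meson Ck_on_local)

lemma smooth_on_subset: "\<lbrakk>open U; V \<subseteq> U; smooth_on U f\<rbrakk> \<Longrightarrow> smooth_on V f"
  unfolding smooth_on_def using Ck_on_subset by blast

lemma smooth_on_compose:
  fixes f :: "'a::real_normed_vector \<Rightarrow> 'b::euclidean_space"
  assumes "open U" "f ` U \<subseteq> V" "smooth_on U f" "smooth_on V g"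
  shows "smooth_on U (g \<circ> f)"
  using assms Ck_on_compose unfolding smooth_on_def by blast

lemma smooth_on_sum:
  "\<lbrakk>open U; \<And>i. i \<in> I \<Longrightarrow> smooth_on U (f i)\<rbrakk> \<Longrightarrow> smooth_on U (\<lambda>x. \<Sum>i\<in>I. f i x)"
  unfolding smooth_on_def by (simp add: Ck_on_sum)

lemma smooth_on_mult:
  fixes f g :: "'a::real_normed_vector \<Rightarrow> real"
  shows "\<lbrakk>open U; smooth_on U f; smooth_on U g\<rbrakk> \<Longrightarrow> smooth_on U (\<lambda>x. f x * g x)"
  unfolding smooth_on_def by (simp add: Ck_on_bounded_bilinear[OF bounded_bilinear_mult])

lemma smooth_on_vec_nth:
  fixes f :: "'a::real_normed_vector \<Rightarrow> real ^ 'n"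
  shows "\<lbrakk>open U; smooth_on U f\<rbrakk> \<Longrightarrow> smooth_on U (\<lambda>x. f x $ i)"
  unfolding smooth_on_def by (simp add: Ck_on_bounded_linear[OF bounded_linear_vec_nth])

lemma smooth_on_differentiable: "\<lbrakk>smooth_on U f; x \<in> U\<rbrakk> \<Longrightarrow> f differentiable (at x)"
  unfolding smooth_on_def using Ck_on.simps(2) by blast

lemma smooth_on_frechet_derivative:
  "smooth_on U f \<Longrightarrow> smooth_on U (\<lambda>x. frechet_derivative f (at x) v)"
  unfolding smooth_on_def using Ck_on.simps(2) by blast

lemma smooth_on_continuous_on: "smooth_on U f \<Longrightarrow> continuous_on U f"
  unfolding smooth_on_def using Ck_on.simps(1) by blast

text \<open>The mean value theorem, applied once in each direction, turns the second difference over a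
  small parallelogram into a mixed second derivative at one of its points. The second difference is
  symmetric in the two directions and hence so is the limit of its quotients.\<close>

lemma second_difference_mean_value:
  fixes f :: "'a::real_normed_vector \<Rightarrow> real"
  assumes df: "\<And>y. y \<in> ball x r \<Longrightarrow> f differentiable (at y)"
    and ddf: "\<And>y. y \<in> ball x r \<Longrightarrow> (\<lambda>z. frechet_derivative f (at z) v) differentiable (at y)"
    and s: "0 < s" "s * (norm v + norm w) < r"
  shows "\<exists>a\<in>{0<..<s}. \<exists>b\<in>{0<..<s}.
    f (x + s *\<^sub>R v + s *\<^sub>R w) - f (x + s *\<^sub>R v) - f (x + s *\<^sub>R w) + f x =
    s\<^sup>2 * frechet_derivative (\<lambda>z. frechet_derivative f (at z) v) (at (x + a *\<^sub>R v + b *\<^sub>R w)) w"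
proof -
  have inb: "x + a *\<^sub>R v + b *\<^sub>R w \<in> ball x r" if "0 \<le> a" "a \<le> s" "0 \<le> b" "b \<le> s" for a b
  proof -
    have "norm (a *\<^sub>R v + b *\<^sub>R w) \<le> a * norm v + b * norm w"
      using norm_triangle_ineq[of "a *\<^sub>R v" "b *\<^sub>R w"] that by simp
    also have "\<dots> \<le> s * norm v + s * norm w"
      using that by (intro add_mono mult_right_mono) auto
    also have "\<dots> < r" using s by (simp add: algebra_simps)
    finally have "norm ((x + a *\<^sub>R v + b *\<^sub>R w) - x) < r" by (simp add: add.assoc)
    then show ?thesis by (metis mem_ball dist_commute dist_norm)
  qed
  define Dv where "Dv = (\<lambda>z. frechet_derivative f (at z) v)"
  define g where "g a = f (x + a *\<^sub>R v + s *\<^sub>R w) - f (x + a *\<^sub>R v + 0 *\<^sub>R w)" for a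
  have f1: "((\<lambda>a. f (x + a *\<^sub>R v + b *\<^sub>R w)) has_derivative
      (\<lambda>t. t * Dv (x + a *\<^sub>R v + b *\<^sub>R w))) (at a within {0..s})"
    if "0 \<le> a" "a \<le> s" "0 \<le> b" "b \<le> s" for a b
  proof -
    note d = df[OF inb[OF that]]
    have "((\<lambda>a. f (x + a *\<^sub>R v + b *\<^sub>R w)) has_derivative
      (\<lambda>t. frechet_derivative f (at (x + a *\<^sub>R v + b *\<^sub>R w)) (t *\<^sub>R v))) (at a within {0..s})"
    proof (rule has_derivative_compose[where g = f])
      show "((\<lambda>a. x + a *\<^sub>R v + b *\<^sub>R w) has_derivative (\<lambda>t. t *\<^sub>R v)) (at a within {0..s})"
        by (auto intro!: derivative_eq_intros)
    qed (use d in \<open>simp add: frechet_derivative_works\<close>)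
    then show ?thesis
      by (simp add: linear_scale[OF linear_frechet_derivative[OF d]] Dv_def)
  qed
  have "\<exists>a\<in>{0<..<s}. g s - g 0 = (s - 0) * Dv (x + a *\<^sub>R v + s *\<^sub>R w)
      - (s - 0) * Dv (x + a *\<^sub>R v + 0 *\<^sub>R w)"
    unfolding g_def using s(1)
    by (intro mvt_simple[where f' = "\<lambda>a t. t * Dv (x + a *\<^sub>R v + s *\<^sub>R w)
      - t * Dv (x + a *\<^sub>R v + 0 *\<^sub>R w)"] has_derivative_diff f1) auto
  then obtain a where a: "a \<in> {0<..<s}"
    and ga: "g s - g 0 = s * (Dv (x + a *\<^sub>R v + s *\<^sub>R w) - Dv (x + a *\<^sub>R v + 0 *\<^sub>R w))"
    by (auto simp: algebra_simps)
  have f2: "((\<lambda>b. Dv (x + a *\<^sub>R v + b *\<^sub>R w)) has_derivative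
      (\<lambda>t. t * frechet_derivative Dv (at (x + a *\<^sub>R v + b *\<^sub>R w)) w)) (at b within {0..s})"
    if "0 \<le> b" "b \<le> s" for b
  proof -
    have d: "Dv differentiable (at (x + a *\<^sub>R v + b *\<^sub>R w))"
      unfolding Dv_def using a that by (intro ddf inb) auto
    have "((\<lambda>b. Dv (x + a *\<^sub>R v + b *\<^sub>R w)) has_derivative
      (\<lambda>t. frechet_derivative Dv (at (x + a *\<^sub>R v + b *\<^sub>R w)) (t *\<^sub>R w))) (at b within {0..s})"
    proof (rule has_derivative_compose[where g = Dv])
      show "((\<lambda>b. x + a *\<^sub>R v + b *\<^sub>R w) has_derivative (\<lambda>t. t *\<^sub>R w)) (at b within {0..s})"
        by (auto intro!: derivative_eq_intros)
    qed (use d in \<open>simp add: frechet_derivative_works\<close>)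
    then show ?thesis
      by (simp add: linear_scale[OF linear_frechet_derivative[OF d]])
  qed
  have "\<exists>b\<in>{0<..<s}. Dv (x + a *\<^sub>R v + s *\<^sub>R w) - Dv (x + a *\<^sub>R v + 0 *\<^sub>R w) =
      (s - 0) * frechet_derivative Dv (at (x + a *\<^sub>R v + b *\<^sub>R w)) w"
    using s(1) by (intro mvt_simple[OF _ f2]) auto
  then obtain b where b: "b \<in> {0<..<s}"
    and gb: "g s - g 0 = s\<^sup>2 * frechet_derivative Dv (at (x + a *\<^sub>R v + b *\<^sub>R w)) w"
    using ga by (auto simp: power2_eq_square)
  have "g s - g 0 = f (x + s *\<^sub>R v + s *\<^sub>R w) - f (x + s *\<^sub>R v) - f (x + s *\<^sub>R w) + f x"
    by (simp add: g_def)
  with a b gb show ?thesis unfolding Dv_def by metis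
qed

lemma second_difference_tendsto:
  fixes f :: "'a::real_normed_vector \<Rightarrow> real"
  assumes "open U" "x \<in> U" "smooth_on U f"
  shows "((\<lambda>s. (f (x + s *\<^sub>R v + s *\<^sub>R w) - f (x + s *\<^sub>R v) - f (x + s *\<^sub>R w) + f x) / s\<^sup>2) \<longlongrightarrow>
    frechet_derivative (\<lambda>z. frechet_derivative f (at z) v) (at x) w) (at_right 0)"
    (is "(?q \<longlongrightarrow> ?D x) _")
proof (rule tendstoI)
  fix e :: real assume "0 < e"
  have "isCont ?D x"
    using smooth_on_continuous_on[OF smooth_on_frechet_derivative[OF
        smooth_on_frechet_derivative[OF assms(3)]]] assms(1,2)
    by (simp add: continuous_on_eq_continuous_at)
  then obtain d where d: "d > 0" "\<And>y. dist y x < d \<Longrightarrow> dist (?D y) (?D x) < e"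
    using \<open>0 < e\<close> unfolding continuous_at_eps_delta by blast
  obtain r where r: "r > 0" "ball x r \<subseteq> U" using assms openE by blast
  \<comment> \<open>For \<open>s < t\<close>, the parallelogram at \<open>x\<close> with edges \<open>s v\<close> and \<open>s w\<close> lies in \<open>U\<close> and in the
    ball on which the mixed derivative is \<open>e\<close>-close to its value at \<open>x\<close>. The added 1 covers the case that both directions vanish.\<close>
  define t where "t = min r d / (norm v + norm w + 1)"
  have n: "0 < norm v + norm w + 1" by (simp add: add_nonneg_pos)
  have "t > 0" using n r d by (simp add: t_def)
  have "dist (?q s) (?D x) < e" if "0 < s" "s < t" for s
  proof -
    have "s * (norm v + norm w + 1) < min r d"
      using that n by (simp add: t_def pos_less_divide_eq)
    then have "s * (norm v + norm w) < min r d" using \<open>0 < s\<close> by (simp add: algebra_simps)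
    then have sr: "s * (norm v + norm w) < r" and sd: "s * (norm v + norm w) < d" by auto
    have "\<exists>a\<in>{0<..<s}. \<exists>b\<in>{0<..<s}.
        f (x + s *\<^sub>R v + s *\<^sub>R w) - f (x + s *\<^sub>R v) - f (x + s *\<^sub>R w) + f x =
        s\<^sup>2 * ?D (x + a *\<^sub>R v + b *\<^sub>R w)"
      using r by (intro second_difference_mean_value[OF _ _ that(1) sr]
          smooth_on_differentiable[OF smooth_on_frechet_derivative[OF assms(3)]]
          smooth_on_differentiable[OF assms(3)]) auto
    then obtain a b where ab: "0 < a" "a < s" "0 < b" "b < s"
      and "?q s = ?D (x + a *\<^sub>R v + b *\<^sub>R w)" using \<open>0 < s\<close> by auto
    moreover have "norm (a *\<^sub>R v + b *\<^sub>R w) < d"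
    proof -
      have "norm (a *\<^sub>R v + b *\<^sub>R w) \<le> a * norm v + b * norm w"
        using norm_triangle_ineq[of "a *\<^sub>R v" "b *\<^sub>R w"] ab by simp
      also have "\<dots> \<le> s * norm v + s * norm w"
        using ab by (intro add_mono mult_right_mono) auto
      finally show ?thesis using sd by (simp add: algebra_simps)
    qed
    ultimately show ?thesis using d(2) by (simp add: dist_norm add.assoc)
  qed
  then show "\<forall>\<^sub>F s in at_right 0. dist (?q s) (?D x) < e"
    using \<open>t > 0\<close> unfolding eventually_at_right_field by blast
qed

lemma frechet_derivative_commute:
  fixes f :: "'a::real_normed_vector \<Rightarrow> real"
  assumes "open U" "x \<in> U" "smooth_on U f"
  shows "frechet_derivative (\<lambda>z. frechet_derivative f (at z) v) (at x) w =
    frechet_derivative (\<lambda>z. frechet_derivative f (at z) w) (at x) v"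
  using second_difference_tendsto[OF assms, of v w] second_difference_tendsto[OF assms, of w v]
  by (intro tendsto_unique[OF trivial_limit_at_right_real]) (simp_all add: algebra_simps)

lemma frechet_derivative_vec_nth:
  fixes f :: "'a::real_normed_vector \<Rightarrow> real ^ 'n"
  assumes "f differentiable (at x)"
  shows "frechet_derivative (\<lambda>z. f z $ i) (at x) v = frechet_derivative f (at x) v $ i"
proof -
  have "((\<lambda>z. f z $ i) has_derivative (\<lambda>v. frechet_derivative f (at x) v $ i)) (at x)"
    using assms by (intro bounded_linear.has_derivative[OF bounded_linear_vec_nth])
      (simp add: frechet_derivative_works)
  then show ?thesis using frechet_derivative_at by metis
qed

lemma frechet_derivative_commute_vec:
  fixes f :: "'a::real_normed_vector \<Rightarrow> real ^ 'n"
  assumes "open U" "x \<in> U" "smooth_on U f"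
  shows "frechet_derivative (\<lambda>z. frechet_derivative f (at z) v) (at x) w =
    frechet_derivative (\<lambda>z. frechet_derivative f (at z) w) (at x) v"
proof -
  have component: "frechet_derivative (\<lambda>z. frechet_derivative f (at z) v) (at x) w $ i =
    frechet_derivative (\<lambda>z. frechet_derivative (\<lambda>z. f z $ i) (at z) v) (at x) w" for i v w
  proof -
    have "frechet_derivative (\<lambda>z. frechet_derivative f (at z) v) (at x) w $ i =
      frechet_derivative (\<lambda>z. frechet_derivative f (at z) v $ i) (at x) w"
      by (rule frechet_derivative_vec_nth[symmetric,
            OF smooth_on_differentiable[OF smooth_on_frechet_derivative[OF assms(3)] assms(2)]])
    also have "\<dots> = frechet_derivative (\<lambda>z. frechet_derivative (\<lambda>z. f z $ i) (at z) v) (at x) w"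
    proof -
      have D: "((\<lambda>z. frechet_derivative f (at z) v $ i) has_derivative
          frechet_derivative (\<lambda>z. frechet_derivative f (at z) v $ i) (at x)) (at x)"
        using smooth_on_differentiable[OF smooth_on_vec_nth[OF assms(1)
              smooth_on_frechet_derivative[OF assms(3)]] assms(2)]
        by (simp add: frechet_derivative_works)
      have "((\<lambda>z. frechet_derivative (\<lambda>z. f z $ i) (at z) v) has_derivative
          frechet_derivative (\<lambda>z. frechet_derivative f (at z) v $ i) (at x)) (at x)"
        using assms(3) by (intro has_derivative_transform_within_open[OF D assms(1,2)])
          (simp add: frechet_derivative_vec_nth[OF smooth_on_differentiable])
      then show ?thesis using frechet_derivative_at by metis
    qed
    finally show ?thesis .
  qed
  show ?thesis
    by (rule vec_eq_iff[THEN iffD2, rule_format], unfold component,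
        rule frechet_derivative_commute[OF assms(1,2) smooth_on_vec_nth[OF assms(1,3)]])
qed


section \<open>Charts and local representatives\<close>

lemma charts_atD:
  assumes "smooth_manifold M" "c \<in> charts_at M p"
  shows "c \<in> atlas M" "p \<in> cdom c" "p \<in> points M" "topological_chart (mtop M) c"
  using assms unfolding smooth_manifold_def charts_at_def by auto

lemma charts_at_nonempty:
  assumes "smooth_manifold M" "p \<in> points M"
  obtains c where "c \<in> charts_at M p"
  using assms unfolding smooth_manifold_def charts_at_def by blast

lemma param_coord:
  assumes "topological_chart X c" "p \<in> cdom c"
  shows "param c (coord c p) = p"
proof -
  have "topspace (subtopology X (cdom c)) = cdom c"
    using assms(1) openin_subset unfolding topological_chart_def by fastforce
  then have "inj_on (coord c) (cdom c)"
    using assms(1) homeomorphic_imp_injective_map unfolding topological_chart_def by metis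
  then show ?thesis using assms(2) by (simp add: param_def)
qed

lemma open_coord_image:
  assumes "topological_chart X c" "openin X S"
  shows "open (coord c ` (cdom c \<inter> S))"
proof -
  have "open_map (subtopology X (cdom c)) (top_of_set (coord c ` cdom c)) (coord c)"
    using assms(1) homeomorphic_imp_open_map unfolding topological_chart_def by blast
  moreover have "openin (subtopology X (cdom c)) (cdom c \<inter> S)"
    using assms(2) by (simp add: openin_subtopology_Int2)
  ultimately have "openin (top_of_set (coord c ` cdom c)) (coord c ` (cdom c \<inter> S))"
    unfolding open_map_def by blast
  then show ?thesis
    using assms(1) openin_open_eq unfolding topological_chart_def by blast
qed

abbreviation overlap :: "('p \<Rightarrow> 'q) \<Rightarrow> ('p, 'm::finite) chart \<Rightarrow> ('q, 'n::finite) chart \<Rightarrow> (real ^ 'm) set"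
  where "overlap f c d \<equiv> coord c ` (cdom c \<inter> f -` cdom d)"

abbreviation local_rep ::
  "('p \<Rightarrow> 'q) \<Rightarrow> ('p, 'm::finite) chart \<Rightarrow> ('q, 'n::finite) chart \<Rightarrow> real ^ 'm \<Rightarrow> real ^ 'n"
  where "local_rep f c d \<equiv> coord d \<circ> f \<circ> param c"

abbreviation local_deriv ::
  "('p \<Rightarrow> 'q) \<Rightarrow> ('p, 'm::finite) chart \<Rightarrow> ('q, 'n::finite) chart \<Rightarrow> 'p \<Rightarrow> real ^ 'm \<Rightarrow> real ^ 'n"
  where "local_deriv f c d p \<equiv> frechet_derivative (local_rep f c d) (at (coord c p))"

text \<open>Functions that agree near a point have the same derivative there. As local representatives
  agree only on overlaps, comparing their derivatives relies on the overlaps being open.\<close>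

lemma open_overlap:
  assumes "smooth_manifold A" "smooth_manifold B" "smooth_map A B f" "c \<in> atlas A" "d \<in> atlas B"
  shows "open (overlap f c d)"
proof -
  have tc: "topological_chart (mtop A) c" and td: "topological_chart (mtop B) d"
    using assms unfolding smooth_manifold_def by auto
  have f: "continuous_map (mtop A) (mtop B) f" using assms(3) unfolding smooth_map_def by blast
  have "openin (mtop A) {x \<in> points A. f x \<in> cdom d}"
    using td by (intro openin_continuous_map_preimage[OF f]) (simp add: topological_chart_def)
  then have "open (coord c ` (cdom c \<inter> {x \<in> points A. f x \<in> cdom d}))"
    by (rule open_coord_image[OF tc])
  moreover have "cdom c \<subseteq> points A" using tc openin_subset unfolding topological_chart_def by blast
  then have "cdom c \<inter> {x \<in> points A. f x \<in> cdom d} = cdom c \<inter> f -` cdom d" by auto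
  ultimately show ?thesis by simp
qed

lemma smooth_local_rep:
  "\<lbrakk>smooth_map A B f; c \<in> atlas A; d \<in> atlas B\<rbrakk> \<Longrightarrow> smooth_on (overlap f c d) (local_rep f c d)"
  unfolding smooth_map_def by blast

lemma mem_overlap:
  assumes "c \<in> charts_at A p" "d \<in> charts_at B (f p)"
  shows "coord c p \<in> overlap f c d"
  using assms unfolding charts_at_def by auto

lemma local_rep_differentiable:
  assumes "smooth_map A B f" "c \<in> charts_at A p" "d \<in> charts_at B (f p)"
  shows "local_rep f c d differentiable (at (coord c p))"
  using smooth_on_differentiable[OF smooth_local_rep[OF assms(1)] mem_overlap[of c A p d B f]] assms
  unfolding charts_at_def by simp

lemma overlapE:
  assumes "y \<in> overlap f c d" "smooth_manifold A" "c \<in> atlas A" "d \<in> atlas B"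
  obtains p where "y = coord c p" "param c y = p" "c \<in> charts_at A p" "d \<in> charts_at B (f p)"
proof -
  from assms(1) obtain p where p: "y = coord c p" "p \<in> cdom c" "f p \<in> cdom d" by auto
  have "topological_chart (mtop A) c" using assms(2,3) unfolding smooth_manifold_def by blast
  with p have "param c y = p" by (simp add: param_coord)
  with p assms(3,4) show ?thesis by (intro that) (simp_all add: charts_at_def)
qed

lemma smooth_map_in_points: "\<lbrakk>smooth_map A B f; p \<in> points A\<rbrakk> \<Longrightarrow> f p \<in> points B"
  using continuous_map_image_subset_topspace unfolding smooth_map_def by fastforce

text \<open>The identity map lets coordinate changes, differentials and their interaction all be instances
  of one chain rule.\<close>

lemma smooth_map_id: "smooth_manifold M \<Longrightarrow> smooth_map M M id"
  unfolding smooth_manifold_def smooth_map_def by simp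

lemma local_deriv_compose:
  assumes "smooth_manifold A" "smooth_manifold B"
    and "smooth_map A B f" "smooth_map B C g"
    and "c \<in> charts_at A p" "d \<in> charts_at B (f p)" "e \<in> charts_at C (g (f p))"
  shows "local_deriv (g \<circ> f) c e p = local_deriv g d e (f p) \<circ> local_deriv f c d p"
proof -
  note D = charts_atD[OF assms(1,5)] and D' = charts_atD[OF assms(2,6)]
  have df: "local_rep f c d differentiable (at (coord c p))"
    by (rule local_rep_differentiable[OF assms(3,5,6)])
  have fp: "local_rep f c d (coord c p) = coord d (f p)"
    using D by (simp add: param_coord)
  have dg: "local_rep g d e differentiable (at (local_rep f c d (coord c p)))"
    unfolding fp by (rule local_rep_differentiable[OF assms(4,6,7)])
  have "frechet_derivative (local_rep g d e \<circ> local_rep f c d) (at (coord c p)) =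
    frechet_derivative (local_rep (g \<circ> f) c e) (at (coord c p))"
  proof (rule frechet_derivative_transform_within_open)
    show "local_rep g d e \<circ> local_rep f c d differentiable (at (coord c p))"
      using df dg by (rule differentiable_chain_at)
    show "open (overlap f c d)" using assms(1-3) D(1) D'(1) by (rule open_overlap)
    show "coord c p \<in> overlap f c d" using assms(5,6) by (rule mem_overlap)
    fix y assume "y \<in> overlap f c d"
    then show "(local_rep g d e \<circ> local_rep f c d) y = local_rep (g \<circ> f) c e y"
      using D(4) D'(4) by (auto simp: param_coord)
  qed
  then show ?thesis unfolding frechet_derivative_compose[OF df dg] fp by (rule sym)
qed

lemma local_deriv_id:
  assumes "smooth_manifold M" "c \<in> charts_at M p"
  shows "local_deriv id c c p u = u"
proof -
  note D = charts_atD[OF assms]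
  have "frechet_derivative id (at (coord c p)) = local_deriv id c c p"
  proof (rule frechet_derivative_transform_within_open)
    show "id differentiable (at (coord c p))" by (simp add: id_def)
    show "open (coord c ` cdom c)" using D(4) unfolding topological_chart_def by blast
  qed (use D in \<open>auto simp: param_coord\<close>)
  then show ?thesis by (metis frechet_derivative_id id_apply)
qed

lemma smooth_functionD:
  assumes "smooth_function M h" "c \<in> charts_at M p"
  shows "(h \<circ> param c) differentiable (at (coord c p))"
  using assms unfolding smooth_function_def charts_at_def
  by (intro smooth_on_differentiable[of "coord c ` cdom c"]) auto

text \<open>Real functions are represented in a chart of the source only, which is why they need a chain
  rule of their own.\<close>

lemma function_deriv_compose:
  assumes "smooth_manifold A" "smooth_manifold B" "smooth_map A B f" "smooth_function B h"
    and "c \<in> charts_at A p" "d \<in> charts_at B (f p)"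
  shows "frechet_derivative (h \<circ> f \<circ> param c) (at (coord c p)) =
    frechet_derivative (h \<circ> param d) (at (coord d (f p))) \<circ> local_deriv f c d p"
proof -
  note D = charts_atD[OF assms(1,5)] and D' = charts_atD[OF assms(2,6)]
  have df: "local_rep f c d differentiable (at (coord c p))"
    by (rule local_rep_differentiable[OF assms(3,5,6)])
  have fp: "local_rep f c d (coord c p) = coord d (f p)"
    using D by (simp add: param_coord)
  have dh: "(h \<circ> param d) differentiable (at (local_rep f c d (coord c p)))"
    unfolding fp by (rule smooth_functionD[OF assms(4,6)])
  have "frechet_derivative ((h \<circ> param d) \<circ> local_rep f c d) (at (coord c p)) =
    frechet_derivative (h \<circ> f \<circ> param c) (at (coord c p))"
  proof (rule frechet_derivative_transform_within_open)
    show "(h \<circ> param d) \<circ> local_rep f c d differentiable (at (coord c p))"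
      using df dh by (rule differentiable_chain_at)
    show "open (overlap f c d)" using assms(1-3) D(1) D'(1) by (rule open_overlap)
    show "coord c p \<in> overlap f c d" using assms(5,6) by (rule mem_overlap)
    fix y assume "y \<in> overlap f c d"
    then show "((h \<circ> param d) \<circ> local_rep f c d) y = (h \<circ> f \<circ> param c) y"
      using D(4) D'(4) by (auto simp: param_coord)
  qed
  then show ?thesis unfolding frechet_derivative_compose[OF df dh] fp by (rule sym)
qed

text \<open>Smoothness on a whole chart domain follows from smoothness on its overlaps with the preimages
  of target charts, which cover it.\<close>

lemma smooth_on_chart_if_smooth_on_overlaps:
  assumes "smooth_manifold A" "smooth_manifold B" "smooth_map A B f" "c \<in> atlas A"
    and "\<And>d. d \<in> atlas B \<Longrightarrow> smooth_on (overlap f c d) g"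
  shows "smooth_on (coord c ` cdom c) g"
proof (rule smooth_on_local)
  fix y assume "y \<in> coord c ` cdom c"
  then obtain p where p: "p \<in> cdom c" "y = coord c p" by auto
  have "p \<in> points A" using charts_atD(3)[OF assms(1), of c p] p assms(4) by (simp add: charts_at_def)
  then have "f p \<in> points B" by (rule smooth_map_in_points[OF assms(3)])
  then obtain d where d: "d \<in> charts_at B (f p)" using charts_at_nonempty[OF assms(2)] by blast
  then show "\<exists>V. open V \<and> y \<in> V \<and> smooth_on V g"
    using p assms open_overlap[of A B f c d] unfolding charts_at_def
    by (intro exI[of _ "overlap f c d"]) auto
qed

lemma smooth_function_compose:
  assumes "smooth_manifold A" "smooth_manifold B" "smooth_map A B f" "smooth_function B h"
  shows "smooth_function A (h \<circ> f)"
  unfolding smooth_function_def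
proof (intro ballI smooth_on_chart_if_smooth_on_overlaps[OF assms(1-3)])
  fix c d assume c: "c \<in> atlas A" and d: "d \<in> atlas B"
  have o: "open (overlap f c d)" using assms(1-3) c d by (rule open_overlap)
  have tc: "topological_chart (mtop A) c" and td: "topological_chart (mtop B) d"
    using assms(1,2) c d unfolding smooth_manifold_def by auto
  have "smooth_on (coord d ` cdom d) (h \<circ> param d)"
    using assms(4) d unfolding smooth_function_def by blast
  moreover have "local_rep f c d ` overlap f c d \<subseteq> coord d ` cdom d"
    using tc by (auto simp: param_coord)
  ultimately have "smooth_on (overlap f c d) ((h \<circ> param d) \<circ> local_rep f c d)"
    using o smooth_local_rep[OF assms(3) c d] by (intro smooth_on_compose) auto
  moreover have "((h \<circ> param d) \<circ> local_rep f c d) y = (h \<circ> f \<circ> param c) y"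
    if "y \<in> overlap f c d" for y
    using that tc td by (auto simp: param_coord)
  ultimately show "smooth_on (overlap f c d) (h \<circ> f \<circ> param c)"
    using o smooth_on_cong by blast
qed


section \<open>Tangent and cotangent spaces in coordinates\<close>

text \<open>The tangent vector with the given components in one chart. It identifies \<open>\<real>\<^sup>n\<close> with
  the tangent space, so that linear algebra on tangent spaces reduces to that of \<open>\<real>\<^sup>n\<close>.\<close>

definition tvec_of :: "('p, 'n::finite) manifold \<Rightarrow> ('p, 'n) chart \<Rightarrow> 'p \<Rightarrow> real ^ 'n \<Rightarrow> ('p, 'n) tvec"
  where "tvec_of M c p u =
    (\<lambda>d. if d \<in> charts_at M p then frechet_derivative (coord d \<circ> param c) (at (coord c p)) u else 0)"

lemma coord_vec_eq_tvec_of: "coord_vec M c i p = tvec_of M c p (axis i 1)"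
  by (simp add: coord_vec_def tvec_of_def)

lemma tvec_of_self: "\<lbrakk>smooth_manifold M; c \<in> charts_at M p\<rbrakk> \<Longrightarrow> tvec_of M c p u c = u"
  using local_deriv_id[of M c p u] by (simp add: tvec_of_def)

lemma transition_deriv_compose:
  assumes "smooth_manifold M" "c \<in> charts_at M p" "d \<in> charts_at M p" "e \<in> charts_at M p"
  shows "frechet_derivative (coord e \<circ> param d) (at (coord d p))
      (frechet_derivative (coord d \<circ> param c) (at (coord c p)) u) =
    frechet_derivative (coord e \<circ> param c) (at (coord c p)) u"
  using local_deriv_compose[OF assms(1,1) smooth_map_id[OF assms(1)] smooth_map_id[OF assms(1)],
      of c p d e] assms by (simp add: fun_eq_iff)

lemma tvec_of_in_tangent_space:
  assumes "smooth_manifold M" "c \<in> charts_at M p"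
  shows "tvec_of M c p u \<in> tangent_space M p"
  unfolding tangent_space_def using transition_deriv_compose[OF assms]
  by (simp add: tvec_of_def)

lemma tangent_transition:
  assumes "v \<in> tangent_space M p" "c \<in> charts_at M p" "d \<in> charts_at M p"
  shows "frechet_derivative (coord d \<circ> param c) (at (coord c p)) (v c) = v d"
proof -
  have "\<forall>c\<in>charts_at M p. \<forall>d\<in>charts_at M p.
      v d = frechet_derivative (coord d \<circ> param c) (at (coord c p)) (v c)"
    using assms(1) unfolding tangent_space_def by blast
  from this[rule_format, OF assms(2,3)] show ?thesis by (rule sym)
qed

lemma tvec_of_component:
  assumes "v \<in> tangent_space M p" "c \<in> charts_at M p"
  shows "tvec_of M c p (v c) = v"
proof
  fix d
  have "v d = 0" if "d \<notin> charts_at M p" using assms(1) that unfolding tangent_space_def by blast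
  then show "tvec_of M c p (v c) d = v d"
    using tangent_transition[OF assms, of d] by (simp add: tvec_of_def)
qed

lemma tangent_vector_eqI:
  assumes "v \<in> tangent_space M p" "w \<in> tangent_space M p" "c \<in> charts_at M p" "v c = w c"
  shows "v = w"
  using assms tvec_of_component by metis

lemma linear_transition_deriv:
  assumes "smooth_manifold M" "c \<in> charts_at M p" "d \<in> charts_at M p"
  shows "linear (frechet_derivative (coord d \<circ> param c) (at (coord c p)))"
  using local_rep_differentiable[OF smooth_map_id[OF assms(1)] assms(2), of d] assms(3)
  by (intro linear_frechet_derivative) simp

lemma tadd_tvec_of:
  assumes "smooth_manifold M" "c \<in> charts_at M p"
  shows "tadd (tvec_of M c p u) (tvec_of M c p w) = tvec_of M c p (u + w)"
  using linear_add[OF linear_transition_deriv[OF assms]] by (auto simp: tadd_def tvec_of_def)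

lemma tscale_tvec_of:
  assumes "smooth_manifold M" "c \<in> charts_at M p"
  shows "tscale a (tvec_of M c p u) = tvec_of M c p (a *\<^sub>R u)"
  using linear_scale[OF linear_transition_deriv[OF assms]] by (auto simp: tscale_def tvec_of_def)

lemma tadd_in_tangent_space:
  assumes "smooth_manifold M" "p \<in> points M" "v \<in> tangent_space M p" "w \<in> tangent_space M p"
  shows "tadd v w \<in> tangent_space M p"
proof -
  obtain c where c: "c \<in> charts_at M p" by (rule charts_at_nonempty[OF assms(1,2)])
  show ?thesis
    using tvec_of_in_tangent_space[OF assms(1) c, of "v c + w c"]
    unfolding tadd_tvec_of[OF assms(1) c, symmetric]
      tvec_of_component[OF assms(3) c] tvec_of_component[OF assms(4) c] .
qed

lemma tscale_in_tangent_space: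
  assumes "smooth_manifold M" "p \<in> points M" "v \<in> tangent_space M p"
  shows "tscale a v \<in> tangent_space M p"
proof -
  obtain c where c: "c \<in> charts_at M p" by (rule charts_at_nonempty[OF assms(1,2)])
  show ?thesis
    using tvec_of_in_tangent_space[OF assms(1) c, of "a *\<^sub>R v c"]
    unfolding tscale_tvec_of[OF assms(1) c, symmetric] tvec_of_component[OF assms(3) c] .
qed

lemma coord_vec_in_tangent_space:
  "\<lbrakk>smooth_manifold M; c \<in> charts_at M p\<rbrakk> \<Longrightarrow> coord_vec M c i p \<in> tangent_space M p"
  by (simp add: coord_vec_eq_tvec_of tvec_of_in_tangent_space)

lemma linear_vec_expansion:
  fixes L :: "real ^ 'n \<Rightarrow> 'b::real_vector"
  assumes "linear L"
  shows "L u = (\<Sum>i\<in>UNIV. (u $ i) *\<^sub>R L (axis i 1))"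
proof -
  have "L (\<Sum>i\<in>UNIV. (u $ i) *\<^sub>R axis i 1) = (\<Sum>i\<in>UNIV. (u $ i) *\<^sub>R L (axis i 1))"
    by (simp add: linear_sum[OF assms] linear_scale[OF assms])
  then show ?thesis using basis_expansion[of u] by (simp add: scalar_mult_eq_scaleR)
qed

lemma tlinear_expansion:
  assumes "smooth_manifold M" "tlinear M p l" "c \<in> charts_at M p" "v \<in> tangent_space M p"
  shows "l v = (\<Sum>i\<in>UNIV. v c $ i * l (coord_vec M c i p))"
proof -
  have "linear (\<lambda>u. l (tvec_of M c p u))"
    using assms(2) tvec_of_in_tangent_space[OF assms(1,3)]
    unfolding tlinear_def
    by (intro linearI) (simp_all add: tadd_tvec_of[OF assms(1,3), symmetric]
        tscale_tvec_of[OF assms(1,3), symmetric])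
  from linear_vec_expansion[OF this, of "v c"] show ?thesis
    by (simp add: tvec_of_component[OF assms(4,3)] coord_vec_eq_tvec_of)
qed

lemma restrict_in_cotangent_space:
  assumes "smooth_manifold M" "p \<in> points M" "tlinear M p l"
  shows "restrict l (tangent_space M p) \<in> cotangent_space M p"
  using assms tadd_in_tangent_space[OF assms(1,2)] tscale_in_tangent_space[OF assms(1,2)]
  unfolding cotangent_space_def tlinear_def by simp

lemma covector_eqI:
  assumes "smooth_manifold M" "l \<in> cotangent_space M p" "l' \<in> cotangent_space M p"
    and c: "c \<in> charts_at M p" and eq: "\<And>i. l (coord_vec M c i p) = l' (coord_vec M c i p)"
  shows "l = l'"
proof (rule extensionalityI)
  show "l \<in> extensional (tangent_space M p)" "l' \<in> extensional (tangent_space M p)"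
    using assms(2,3) by (simp_all add: cotangent_space_def)
  have lin: "tlinear M p l" "tlinear M p l'" using assms(2,3) by (simp_all add: cotangent_space_def)
  fix v assume v: "v \<in> tangent_space M p"
  show "l v = l' v"
    unfolding tlinear_expansion[OF assms(1) lin(1) c v] tlinear_expansion[OF assms(1) lin(2) c v] eq ..
qed


section \<open>The isomorphisms given by a nondegenerate tensor\<close>

lemma tensor_expansion:
  assumes "smooth_manifold M" "tensor_field02 M \<tau>" "c \<in> charts_at M p"
    and v: "v \<in> tangent_space M p" and w: "w \<in> tangent_space M p"
  shows "\<tau> p v w = (\<Sum>i\<in>UNIV. \<Sum>j\<in>UNIV. tcoeff M \<tau> c i j p * v c $ i * w c $ j)"
proof -
  have p: "p \<in> points M" by (rule charts_atD(3)[OF assms(1,3)])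
  have "\<tau> p v w = (\<Sum>i\<in>UNIV. v c $ i * \<tau> p (coord_vec M c i p) w)"
    using assms(2) p w by (intro tlinear_expansion[OF assms(1) _ assms(3) v]) (simp add: tensor_field02_def)
  also have "\<dots> = (\<Sum>i\<in>UNIV. v c $ i * (\<Sum>j\<in>UNIV. w c $ j * tcoeff M \<tau> c i j p))"
    unfolding tcoeff_def
    using assms(2) p coord_vec_in_tangent_space[OF assms(1,3)]
    by (subst tlinear_expansion[OF assms(1) _ assms(3) w]) (simp_all add: tensor_field02_def)
  finally show ?thesis by (simp add: sum_distrib_left mult_ac)
qed

text \<open>The defining components of \<open>flat\<close> are those of the covector that puts \<open>v\<close> into the second
  slot of \<open>\<tau>\<close>, in every chart at once, and a covector is determined by its components in a
  single chart.\<close>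

lemma flat_eq:
  assumes "smooth_manifold M" "tensor_field02 M \<tau>" "p \<in> points M" "v \<in> tangent_space M p"
  shows "flat M \<tau> p v = restrict (\<lambda>w. \<tau> p w v) (tangent_space M p)" (is "_ = ?l")
  unfolding flat_def
proof (rule the_equality)
  have l: "?l \<in> cotangent_space M p"
    using assms by (intro restrict_in_cotangent_space) (simp_all add: tensor_field02_def)
  have comp: "?l (coord_vec M c i p) = (\<Sum>j\<in>UNIV. tcoeff M \<tau> c i j p * v c $ j)"
    if c: "c \<in> charts_at M p" for c i
  proof -
    have "\<tau> p (coord_vec M c i p) v = (\<Sum>j\<in>UNIV. v c $ j * tcoeff M \<tau> c i j p)"
      unfolding tcoeff_def using assms coord_vec_in_tangent_space[OF assms(1) c]
      by (intro tlinear_expansion[OF assms(1) _ c assms(4)]) (simp add: tensor_field02_def)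
    then show ?thesis using coord_vec_in_tangent_space[OF assms(1) c] by (simp add: mult.commute)
  qed
  show "?l \<in> cotangent_space M p \<and>
    (\<forall>c\<in>charts_at M p. \<forall>i. ?l (coord_vec M c i p) = (\<Sum>j\<in>UNIV. tcoeff M \<tau> c i j p * v c $ j))"
    using l comp by blast
  fix l' assume l': "l' \<in> cotangent_space M p \<and>
    (\<forall>c\<in>charts_at M p. \<forall>i. l' (coord_vec M c i p) = (\<Sum>j\<in>UNIV. tcoeff M \<tau> c i j p * v c $ j))"
  obtain c where c: "c \<in> charts_at M p" by (rule charts_at_nonempty[OF assms(1,3)])
  show "l' = ?l"
    using l' comp[OF c] c by (intro covector_eqI[OF assms(1) _ l c]) simp_all
qed

text \<open>In a chart, the flat map is multiplication by the coefficient matrix of \<open>\<tau>\<close>, so a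
  preimage of \<open>l\<close> is found by applying the inverse matrix to its components.\<close>

lemma flat_surjective:
  assumes "smooth_manifold M" "tensor_field02 M \<tau>" "nondegenerate M \<tau>" "p \<in> points M"
    and "l \<in> cotangent_space M p"
  shows "l \<in> flat M \<tau> p ` tangent_space M p"
proof -
  obtain c where c: "c \<in> charts_at M p" by (rule charts_at_nonempty[OF assms(1,4)])
  define A where "A = (\<chi> i j. tcoeff M \<tau> c i j p)"
  define b where "b = (\<chi> i. l (coord_vec M c i p))"
  have "invertible A" using assms(3,4) c unfolding nondegenerate_def A_def by blast
  then obtain A' where "A ** A' = mat 1" using invertible_right_inverse by blast
  then have Ab: "A *v (A' *v b) = b" by (simp add: matrix_vector_mul_assoc)
  define v where "v = tvec_of M c p (A' *v b)"
  have v: "v \<in> tangent_space M p" "v c = A' *v b"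
    using tvec_of_in_tangent_space[OF assms(1) c] tvec_of_self[OF assms(1) c] by (auto simp: v_def)
  have "flat M \<tau> p v = l"
  proof (rule covector_eqI[OF assms(1) _ assms(5) c])
    show "flat M \<tau> p v \<in> cotangent_space M p"
      unfolding flat_eq[OF assms(1,2,4) v(1)]
      using assms v by (intro restrict_in_cotangent_space) (simp_all add: tensor_field02_def)
    fix i
    have "flat M \<tau> p v (coord_vec M c i p) = \<tau> p (coord_vec M c i p) v"
      using coord_vec_in_tangent_space[OF assms(1) c] by (simp add: flat_eq[OF assms(1,2,4) v(1)])
    also have "\<dots> = (\<Sum>j\<in>UNIV. v c $ j * tcoeff M \<tau> c i j p)"
      unfolding tcoeff_def using assms coord_vec_in_tangent_space[OF assms(1) c]
      by (intro tlinear_expansion[OF assms(1) _ c v(1)]) (simp add: tensor_field02_def)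
    also have "\<dots> = (A *v (A' *v b)) $ i"
      unfolding v(2)[symmetric] by (simp add: matrix_vector_mult_def A_def mult.commute)
    finally show "flat M \<tau> p v (coord_vec M c i p) = l (coord_vec M c i p)"
      unfolding Ab by (simp add: b_def)
  qed
  with v(1) show ?thesis by blast
qed

text \<open>This is the only property of \<open>sharp\<close> that the reduction rests on: the Hamiltonian vector field
  is handed to \<open>flat\<close>, which recovers the differential of the Hamiltonian.\<close>

lemma flat_sharp:
  assumes "smooth_manifold M" "tensor_field02 M \<tau>" "nondegenerate M \<tau>" "p \<in> points M"
    and "l \<in> cotangent_space M p"
  shows "flat M \<tau> p (sharp M \<tau> p l) = l"
  unfolding sharp_def using flat_surjective[OF assms] by (rule f_inv_into_f)


section \<open>Differentials\<close>

text \<open>One pair of charts determines a candidate for \<open>df(v)\<close>. Its components in all other charts are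
  the required ones by the chain rule, applied to \<open>id \<circ> f\<close> for a change of target chart and to
  \<open>f \<circ> id\<close> for a change of source chart.\<close>

lemma differential_spec:
  assumes "smooth_manifold A" "smooth_manifold B" "smooth_map A B f"
    and "p \<in> points A" "v \<in> tangent_space A p"
  shows "differential A B f p v \<in> tangent_space B (f p) \<and>
    (\<forall>c\<in>charts_at A p. \<forall>d\<in>charts_at B (f p). differential A B f p v d = local_deriv f c d p (v c))"
proof -
  have fp: "f p \<in> points B" by (rule smooth_map_in_points[OF assms(3,4)])
  obtain c where c: "c \<in> charts_at A p" by (rule charts_at_nonempty[OF assms(1,4)])
  obtain d where d: "d \<in> charts_at B (f p)" by (rule charts_at_nonempty[OF assms(2) fp])
  define w where "w = tvec_of B d (f p) (local_deriv f c d p (v c))"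
  have w: "w \<in> tangent_space B (f p)" unfolding w_def by (rule tvec_of_in_tangent_space[OF assms(2) d])
  have rep: "w e = local_deriv f b e p (v b)" if b: "b \<in> charts_at A p" and e: "e \<in> charts_at B (f p)" for b e
  proof -
    have "w e = local_deriv id d e (f p) (local_deriv f c d p (v c))"
      using e by (simp add: w_def tvec_of_def)
    also have "\<dots> = local_deriv f c e p (v c)"
      using local_deriv_compose[OF assms(1-3) smooth_map_id[OF assms(2)] c d, of e] e
      by (simp add: fun_eq_iff)
    also have "\<dots> = local_deriv f b e p (local_deriv id c b p (v c))"
      using local_deriv_compose[OF assms(1,1) smooth_map_id[OF assms(1)] assms(3) c, of b e] b e
      by (simp add: fun_eq_iff)
    also have "local_deriv id c b p (v c) = v b"
      using tangent_transition[OF assms(5) c b] by simp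
    finally show ?thesis .
  qed
  have unique: "\<exists>!w. w \<in> tangent_space B (f p) \<and>
    (\<forall>c\<in>charts_at A p. \<forall>d\<in>charts_at B (f p). w d = local_deriv f c d p (v c))"
  proof (rule ex1I)
    show "w \<in> tangent_space B (f p) \<and>
      (\<forall>c\<in>charts_at A p. \<forall>d\<in>charts_at B (f p). w d = local_deriv f c d p (v c))"
      using w rep by blast
    fix w' assume w': "w' \<in> tangent_space B (f p) \<and>
      (\<forall>c\<in>charts_at A p. \<forall>d\<in>charts_at B (f p). w' d = local_deriv f c d p (v c))"
    show "w' = w"
      using w' c d rep[OF c d] by (intro tangent_vector_eqI[OF _ w d]) auto
  qed
  from theI'[OF unique] show ?thesis unfolding differential_def .
qed

lemmas differential_in_tangent_space = differential_spec[THEN conjunct1]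
lemmas differential_component = differential_spec[THEN conjunct2, rule_format]

lemma differential_tadd:
  assumes AB: "smooth_manifold A" "smooth_manifold B" "smooth_map A B f" "p \<in> points A"
    and v: "v \<in> tangent_space A p" and w: "w \<in> tangent_space A p"
  shows "differential A B f p (tadd v w) = tadd (differential A B f p v) (differential A B f p w)"
proof -
  have fp: "f p \<in> points B" by (rule smooth_map_in_points[OF AB(3,4)])
  obtain c where c: "c \<in> charts_at A p" by (rule charts_at_nonempty[OF AB(1,4)])
  obtain d where d: "d \<in> charts_at B (f p)" by (rule charts_at_nonempty[OF AB(2) fp])
  note T = tadd_in_tangent_space[OF AB(1,4) v w]
  note lin = linear_frechet_derivative[OF local_rep_differentiable[OF AB(3) c d]]
  show ?thesis
  proof (rule tangent_vector_eqI[OF _ _ d])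
    show "differential A B f p (tadd v w) d = tadd (differential A B f p v) (differential A B f p w) d"
      using differential_component[OF AB T c d] differential_component[OF AB v c d]
        differential_component[OF AB w c d] linear_add[OF lin, of "v c" "w c"] by (simp add: tadd_def)
  qed (intro tadd_in_tangent_space differential_in_tangent_space AB T v w fp)+
qed

lemma differential_tscale:
  assumes AB: "smooth_manifold A" "smooth_manifold B" "smooth_map A B f" "p \<in> points A"
    and v: "v \<in> tangent_space A p"
  shows "differential A B f p (tscale a v) = tscale a (differential A B f p v)"
proof -
  have fp: "f p \<in> points B" by (rule smooth_map_in_points[OF AB(3,4)])
  obtain c where c: "c \<in> charts_at A p" by (rule charts_at_nonempty[OF AB(1,4)])
  obtain d where d: "d \<in> charts_at B (f p)" by (rule charts_at_nonempty[OF AB(2) fp])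
  note T = tscale_in_tangent_space[OF AB(1,4) v]
  note lin = linear_frechet_derivative[OF local_rep_differentiable[OF AB(3) c d]]
  show ?thesis
  proof (rule tangent_vector_eqI[OF _ _ d])
    show "differential A B f p (tscale a v) d = tscale a (differential A B f p v) d"
      using differential_component[OF AB T c d] differential_component[OF AB v c d]
        linear_scale[OF lin, of a "v c"] by (simp add: tscale_def)
  qed (intro tscale_in_tangent_space differential_in_tangent_space AB T v fp)+
qed

text \<open>As for maps, one chart determines the covector, and the chain rule for \<open>h \<circ> id\<close> makes it
  agree with all others.\<close>

lemma dfun_spec:
  assumes "smooth_manifold M" "smooth_function M h" "p \<in> points M"
  shows "dfun M h p \<in> cotangent_space M p \<and>
    (\<forall>c\<in>charts_at M p. \<forall>v\<in>tangent_space M p.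
       dfun M h p v = frechet_derivative (h \<circ> param c) (at (coord c p)) (v c))"
proof -
  obtain c where c: "c \<in> charts_at M p" by (rule charts_at_nonempty[OF assms(1,3)])
  define l where "l = restrict (\<lambda>v. frechet_derivative (h \<circ> param c) (at (coord c p)) (v c))
    (tangent_space M p)"
  note lin = linear_frechet_derivative[OF smooth_functionD[OF assms(2) c]]
  have lc: "l \<in> cotangent_space M p"
    unfolding l_def using linear_add[OF lin] linear_scale[OF lin]
    by (intro restrict_in_cotangent_space assms) (simp add: tlinear_def tadd_def tscale_def)
  have rep: "l v = frechet_derivative (h \<circ> param d) (at (coord d p)) (v d)"
    if d: "d \<in> charts_at M p" and v: "v \<in> tangent_space M p" for d v
  proof -
    have "v d = local_deriv id c d p (v c)" using tangent_transition[OF v c d] by simp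
    then show ?thesis
      using function_deriv_compose[OF assms(1,1) smooth_map_id[OF assms(1)] assms(2) c, of d] d v
      by (simp add: l_def)
  qed
  have unique: "\<exists>!l. l \<in> cotangent_space M p \<and> (\<forall>c\<in>charts_at M p. \<forall>v\<in>tangent_space M p.
      l v = frechet_derivative (h \<circ> param c) (at (coord c p)) (v c))"
  proof (intro ex1I[of _ l] conjI ballI)
    fix l' assume l': "l' \<in> cotangent_space M p \<and> (\<forall>c\<in>charts_at M p. \<forall>v\<in>tangent_space M p.
      l' v = frechet_derivative (h \<circ> param c) (at (coord c p)) (v c))"
    show "l' = l"
    proof (rule covector_eqI[OF assms(1) _ lc c])
      fix i
      note cv = coord_vec_in_tangent_space[OF assms(1) c, of i]
      show "l' (coord_vec M c i p) = l (coord_vec M c i p)"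
        using l' c cv unfolding rep[OF c cv] by blast
    qed (use l' in blast)
  qed (use lc rep in blast)+
  from theI'[OF unique] show ?thesis unfolding dfun_def .
qed

text \<open>Naturality of the exterior derivative on functions, which is the chain rule. It is this identity
  that turns the pulled back covector \<open>dH\<close> into the differential of the reduced Hamiltonian.\<close>

lemma covec_pullback_dfun:
  assumes AB: "smooth_manifold A" "smooth_manifold B" "smooth_map A B f" "p \<in> points A"
    and h: "smooth_function B h"
  shows "covec_pullback A B f p (dfun B h (f p)) = dfun A (h \<circ> f) p"
proof (rule extensionalityI)
  have fp: "f p \<in> points B" by (rule smooth_map_in_points[OF AB(3,4)])
  note hf = smooth_function_compose[OF AB(1-3) h]
  note spec = dfun_spec[OF AB(1) hf AB(4)] and spec' = dfun_spec[OF AB(2) h fp]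
  show "covec_pullback A B f p (dfun B h (f p)) \<in> extensional (tangent_space A p)"
    by (simp add: covec_pullback_def)
  show "dfun A (h \<circ> f) p \<in> extensional (tangent_space A p)"
    using spec by (simp add: cotangent_space_def)
  fix v assume v: "v \<in> tangent_space A p"
  obtain c where c: "c \<in> charts_at A p" by (rule charts_at_nonempty[OF AB(1,4)])
  obtain d where d: "d \<in> charts_at B (f p)" by (rule charts_at_nonempty[OF AB(2) fp])
  show "covec_pullback A B f p (dfun B h (f p)) v = dfun A (h \<circ> f) p v"
    using spec spec' c d v differential_spec[OF AB v]
      function_deriv_compose[OF AB(1-3) h c d]
    by (simp add: covec_pullback_def)
qed


section \<open>Pullbacks of closed forms in coordinates\<close>

text \<open>Think of \<open>w c a b\<close> as the partial derivative in direction \<open>c\<close> of the coefficient \<open>(a, b)\<close> of a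
  2-form. The assumption says that this form is closed and the conclusion that its exterior
  derivative vanishes on arbitrary vectors \<open>x, y, z\<close>, not only on coordinate vectors. Renaming the
  summation indices cyclically gives the three sums the common factor \<open>x c * y a * z b\<close>.\<close>

lemma sum_cyclic_zero:
  fixes w :: "'i::finite \<Rightarrow> 'i \<Rightarrow> 'i \<Rightarrow> real" and x y z :: "'i \<Rightarrow> real"
  assumes "\<And>a b c. w a b c + w b c a + w c a b = 0"
  shows "(\<Sum>a\<in>UNIV. \<Sum>b\<in>UNIV. (\<Sum>c\<in>UNIV. x c * w c a b) * y a * z b) +
    (\<Sum>a\<in>UNIV. \<Sum>b\<in>UNIV. (\<Sum>c\<in>UNIV. y c * w c a b) * z a * x b) +
    (\<Sum>a\<in>UNIV. \<Sum>b\<in>UNIV. (\<Sum>c\<in>UNIV. z c * w c a b) * x a * y b) = 0"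
proof -
  have "(\<Sum>a\<in>UNIV. \<Sum>b\<in>UNIV. (\<Sum>c\<in>UNIV. x c * w c a b) * y a * z b) =
      (\<Sum>a\<in>UNIV. \<Sum>b\<in>UNIV. \<Sum>c\<in>UNIV. w c a b * (x c * y a * z b))"
    by (simp add: sum_distrib_right sum_distrib_left mult_ac)
  moreover have "(\<Sum>a\<in>UNIV. \<Sum>b\<in>UNIV. (\<Sum>c\<in>UNIV. y c * w c a b) * z a * x b) =
      (\<Sum>a\<in>UNIV. \<Sum>b\<in>UNIV. \<Sum>c\<in>UNIV. w a b c * (x c * y a * z b))"
  proof -
    have "(\<Sum>a\<in>UNIV. \<Sum>b\<in>UNIV. (\<Sum>c\<in>UNIV. y c * w c a b) * z a * x b) =
        (\<Sum>b\<in>UNIV. \<Sum>c\<in>UNIV. \<Sum>a\<in>UNIV. w a b c * (x c * y a * z b))"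
      by (simp add: sum_distrib_right sum_distrib_left mult_ac)
    also have "\<dots> = (\<Sum>b\<in>UNIV. \<Sum>a\<in>UNIV. \<Sum>c\<in>UNIV. w a b c * (x c * y a * z b))"
      by (intro sum.cong refl sum.swap)
    also have "\<dots> = (\<Sum>a\<in>UNIV. \<Sum>b\<in>UNIV. \<Sum>c\<in>UNIV. w a b c * (x c * y a * z b))"
      by (rule sum.swap)
    finally show ?thesis .
  qed
  moreover have "(\<Sum>a\<in>UNIV. \<Sum>b\<in>UNIV. (\<Sum>c\<in>UNIV. z c * w c a b) * x a * y b) =
      (\<Sum>a\<in>UNIV. \<Sum>b\<in>UNIV. \<Sum>c\<in>UNIV. w b c a * (x c * y a * z b))"
  proof -
    have "(\<Sum>a\<in>UNIV. \<Sum>b\<in>UNIV. (\<Sum>c\<in>UNIV. z c * w c a b) * x a * y b) =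
        (\<Sum>c\<in>UNIV. \<Sum>a\<in>UNIV. \<Sum>b\<in>UNIV. w b c a * (x c * y a * z b))"
      by (simp add: sum_distrib_right sum_distrib_left mult_ac)
    also have "\<dots> = (\<Sum>a\<in>UNIV. \<Sum>c\<in>UNIV. \<Sum>b\<in>UNIV. w b c a * (x c * y a * z b))"
      by (rule sum.swap)
    also have "\<dots> = (\<Sum>a\<in>UNIV. \<Sum>b\<in>UNIV. \<Sum>c\<in>UNIV. w b c a * (x c * y a * z b))"
      by (intro sum.cong refl sum.swap)
    finally show ?thesis .
  qed
  moreover have "(\<Sum>a\<in>UNIV. \<Sum>b\<in>UNIV. \<Sum>c\<in>UNIV. w c a b * (x c * y a * z b)) +
      (\<Sum>a\<in>UNIV. \<Sum>b\<in>UNIV. \<Sum>c\<in>UNIV. w a b c * (x c * y a * z b)) +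
      (\<Sum>a\<in>UNIV. \<Sum>b\<in>UNIV. \<Sum>c\<in>UNIV. w b c a * (x c * y a * z b)) =
      (\<Sum>a\<in>UNIV. \<Sum>b\<in>UNIV. \<Sum>c\<in>UNIV. (w c a b + w a b c + w b c a) * (x c * y a * z b))"
    by (simp only: sum.distrib distrib_right)
  ultimately show ?thesis using assms by simp
qed

text \<open>The value at \<open>y\<close> of the pullback by \<open>F\<close> of the (0,2)-tensor with coefficients \<open>W\<close>, on the
  vectors \<open>u\<close> and \<open>v\<close>.\<close>

definition pullback_coeff ::
  "('m \<Rightarrow> 'm \<Rightarrow> real ^ 'm::finite \<Rightarrow> real) \<Rightarrow> (real ^ 'n::finite \<Rightarrow> real ^ 'm) \<Rightarrow>
   real ^ 'n \<Rightarrow> real ^ 'n \<Rightarrow> real ^ 'n \<Rightarrow> real" where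
  "pullback_coeff W F u v y = (\<Sum>a\<in>UNIV. \<Sum>b\<in>UNIV.
     W a b (F y) * frechet_derivative F (at y) u $ a * frechet_derivative F (at y) v $ b)"

lemma smooth_pullback_coeff:
  assumes "open U" "smooth_on U F" "F ` U \<subseteq> V" "\<And>a b. smooth_on V (W a b)"
  shows "smooth_on U (pullback_coeff W F u v)"
proof -
  have "smooth_on U (\<lambda>y. W a b (F y))" for a b
    using smooth_on_compose[OF assms(1,3,2,4)] by (simp add: o_def)
  then show ?thesis
    unfolding pullback_coeff_def
    by (intro smooth_on_sum smooth_on_mult smooth_on_vec_nth smooth_on_frechet_derivative assms(1,2))
qed

lemma frechet_derivative_pullback_coeff:
  fixes F :: "real ^ 'n::finite \<Rightarrow> real ^ 'm::finite"
  assumes "smooth_on U F" "y \<in> U" "\<And>a b. W a b differentiable (at (F y))"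
  shows "frechet_derivative (pullback_coeff W F u v) (at y) w =
    (\<Sum>a\<in>UNIV. \<Sum>b\<in>UNIV. frechet_derivative (W a b) (at (F y)) (frechet_derivative F (at y) w)
      * frechet_derivative F (at y) u $ a * frechet_derivative F (at y) v $ b) +
    (\<Sum>a\<in>UNIV. \<Sum>b\<in>UNIV. W a b (F y)
      * frechet_derivative (\<lambda>z. frechet_derivative F (at z) u) (at y) w $ a
      * frechet_derivative F (at y) v $ b) +
    (\<Sum>a\<in>UNIV. \<Sum>b\<in>UNIV. W a b (F y) * frechet_derivative F (at y) u $ a
      * frechet_derivative (\<lambda>z. frechet_derivative F (at z) v) (at y) w $ b)"
proof -
  have dF: "(F has_derivative frechet_derivative F (at y)) (at y)"
    using smooth_on_differentiable[OF assms(1,2)] by (simp add: frechet_derivative_works)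
  have dW: "((\<lambda>z. W a b (F z)) has_derivative
      (\<lambda>w. frechet_derivative (W a b) (at (F y)) (frechet_derivative F (at y) w))) (at y)" for a b
    using diff_chain_at[OF dF, of "W a b"] assms(3) by (simp add: frechet_derivative_works o_def)
  have dDF: "((\<lambda>z. frechet_derivative F (at z) u $ a) has_derivative
      (\<lambda>w. frechet_derivative (\<lambda>z. frechet_derivative F (at z) u) (at y) w $ a)) (at y)" for u a
    using smooth_on_differentiable[OF smooth_on_frechet_derivative[OF assms(1)] assms(2)]
    by (intro bounded_linear.has_derivative[OF bounded_linear_vec_nth])
      (simp add: frechet_derivative_works)
  have "(pullback_coeff W F u v has_derivative (\<lambda>w. \<Sum>a\<in>UNIV. \<Sum>b\<in>UNIV.
      W a b (F y) * frechet_derivative F (at y) u $ a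
        * frechet_derivative (\<lambda>z. frechet_derivative F (at z) v) (at y) w $ b
      + (W a b (F y) * frechet_derivative (\<lambda>z. frechet_derivative F (at z) u) (at y) w $ a
        + frechet_derivative (W a b) (at (F y)) (frechet_derivative F (at y) w)
          * frechet_derivative F (at y) u $ a) * frechet_derivative F (at y) v $ b)) (at y)"
    unfolding pullback_coeff_def
    by (intro has_derivative_sum has_derivative_mult dW dDF)
  from frechet_derivative_at[OF this, symmetric] show ?thesis
    by (simp add: sum.distrib algebra_simps)
qed

text \<open>The pullback of a closed 2-form is closed. Of the three groups of terms in the derivative
  above, the cyclic sum of the first is the exterior derivative of \<open>W\<close> on the images of the three
  vectors, hence zero. The others contain second derivatives of \<open>F\<close>; they cancel in pairs because
  \<open>W\<close> is skew and second derivatives commute.\<close>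

lemma closed_pullback_coeff:
  fixes F :: "real ^ 'n::finite \<Rightarrow> real ^ 'm::finite"
  assumes "open U" "smooth_on U F" "y \<in> U" and W: "\<And>a b. W a b differentiable (at (F y))"
    and skew: "\<And>a b. W a b (F y) = - W b a (F y)"
    and closed: "\<And>a b c. frechet_derivative (W b c) (at (F y)) (axis a 1)
      + frechet_derivative (W c a) (at (F y)) (axis b 1)
      + frechet_derivative (W a b) (at (F y)) (axis c 1) = 0"
  shows "frechet_derivative (pullback_coeff W F v w) (at y) u
    + frechet_derivative (pullback_coeff W F w u) (at y) v
    + frechet_derivative (pullback_coeff W F u v) (at y) w = 0"
proof -
  define D where "D = frechet_derivative F (at y)"
  define D2 where "D2 u v = frechet_derivative (\<lambda>z. frechet_derivative F (at z) u) (at y) v" for u v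
  define B where "B x x' = (\<Sum>a\<in>UNIV. \<Sum>b\<in>UNIV. W a b (F y) * x $ a * x' $ b)" for x x' :: "real ^ 'm"
  define E where "E x x' x'' = (\<Sum>a\<in>UNIV. \<Sum>b\<in>UNIV.
    frechet_derivative (W a b) (at (F y)) x * x' $ a * x'' $ b)" for x x' x'' :: "real ^ 'm"
  have deriv: "frechet_derivative (pullback_coeff W F u v) (at y) w =
    E (D w) (D u) (D v) + B (D2 u w) (D v) + B (D u) (D2 v w)" for u v w
    unfolding E_def B_def D_def D2_def by (rule frechet_derivative_pullback_coeff[OF assms(2,3) W])
  have D2: "D2 u v = D2 v u" for u v
    unfolding D2_def by (rule frechet_derivative_commute_vec[OF assms(1,3,2)])
  have B: "B x x' = - B x' x" for x x'
  proof -
    have "B x x' = (\<Sum>a\<in>UNIV. \<Sum>b\<in>UNIV. - (W b a (F y) * x' $ b * x $ a))"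
      unfolding B_def by (subst skew) (simp add: mult_ac)
    also have "\<dots> = (\<Sum>b\<in>UNIV. \<Sum>a\<in>UNIV. - (W b a (F y) * x' $ b * x $ a))" by (rule sum.swap)
    finally show ?thesis by (simp add: B_def sum_negf)
  qed
  have E: "E x x' x'' = (\<Sum>a\<in>UNIV. \<Sum>b\<in>UNIV.
      (\<Sum>c\<in>UNIV. x $ c * frechet_derivative (W a b) (at (F y)) (axis c 1)) * x' $ a * x'' $ b)" for x x' x''
    unfolding E_def linear_vec_expansion[OF linear_frechet_derivative[OF W], of _ _ x] by simp
  have "E (D u) (D v) (D w) + E (D v) (D w) (D u) + E (D w) (D u) (D v) = 0"
    unfolding E
    by (rule sum_cyclic_zero[of "\<lambda>c a b. frechet_derivative (W a b) (at (F y)) (axis c 1)"])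
      (rule closed)
  moreover have "B (D2 v u) (D w) = - B (D w) (D2 u v)" "B (D2 w v) (D u) = - B (D u) (D2 v w)"
    "B (D2 u w) (D v) = - B (D v) (D2 w u)"
    using B D2 by metis+
  ultimately show ?thesis unfolding deriv by simp
qed


section \<open>Pullbacks of symplectic forms\<close>

text \<open>Each defining property of a symplectic form other than nondegeneracy is inherited by pullbacks
  along arbitrary smooth maps.\<close>

lemma tensor_field02_pullback:
  assumes "smooth_manifold N" "smooth_manifold M" "smooth_map N M \<phi>" "tensor_field02 M \<omega>"
  shows "tensor_field02 N (tensor_pullback N M \<phi> \<omega>)"
  unfolding tensor_field02_def tlinear_def tensor_pullback_def
proof (intro ballI conjI allI)
  fix q assume q: "q \<in> points N"
  then have \<phi>q: "\<phi> q \<in> points M" by (rule smooth_map_in_points[OF assms(3)])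
  let ?d = "differential N M \<phi> q"
  fix v assume v: "v \<in> tangent_space N q"
  have d: "?d x \<in> tangent_space M (\<phi> q)" if "x \<in> tangent_space N q" for x
    by (rule differential_in_tangent_space[OF assms(1-3) q that])
  have lin: "tlinear M (\<phi> q) (\<omega> (\<phi> q) (?d v))" "tlinear M (\<phi> q) (\<lambda>x. \<omega> (\<phi> q) x (?d v))"
    using assms(4) \<phi>q d[OF v] unfolding tensor_field02_def by auto
  fix w assume w: "w \<in> tangent_space N q"
  show "\<omega> (\<phi> q) (?d v) (?d (tscale a w)) = a * \<omega> (\<phi> q) (?d v) (?d w)" for a
    using lin(1) d[OF w] differential_tscale[OF assms(1-3) q w] by (simp add: tlinear_def)
  show "\<omega> (\<phi> q) (?d (tscale a w)) (?d v) = a * \<omega> (\<phi> q) (?d w) (?d v)" for a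
    using lin(2) d[OF w] differential_tscale[OF assms(1-3) q w] by (simp add: tlinear_def)
  fix x assume x: "x \<in> tangent_space N q"
  show "\<omega> (\<phi> q) (?d v) (?d (tadd w x)) = \<omega> (\<phi> q) (?d v) (?d w) + \<omega> (\<phi> q) (?d v) (?d x)"
    using lin(1) d[OF w] d[OF x] differential_tadd[OF assms(1-3) q w x] by (simp add: tlinear_def)
  show "\<omega> (\<phi> q) (?d (tadd w x)) (?d v) = \<omega> (\<phi> q) (?d w) (?d v) + \<omega> (\<phi> q) (?d x) (?d v)"
    using lin(2) d[OF w] d[OF x] differential_tadd[OF assms(1-3) q w x] by (simp add: tlinear_def)
qed

text \<open>The bridge to the calculus of the previous section: by bilinearity, the coefficients of the
  pullback in \<open>c\<close> are polynomial in those of \<open>\<omega>\<close> in \<open>d\<close> and in the Jacobian of the local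
  representative of \<open>\<phi>\<close>.\<close>

lemma tcoeff_pullback:
  assumes "smooth_manifold N" "smooth_manifold M" "smooth_map N M \<phi>" "tensor_field02 M \<omega>"
    and c: "c \<in> atlas N" and d: "d \<in> atlas M" and y: "y \<in> overlap \<phi> c d"
  shows "(tcoeff N (tensor_pullback N M \<phi> \<omega>) c i j \<circ> param c) y =
    pullback_coeff (\<lambda>a b. tcoeff M \<omega> d a b \<circ> param d) (local_rep \<phi> c d) (axis i 1) (axis j 1) y"
proof -
  obtain q where q: "y = coord c q" "param c y = q" "c \<in> charts_at N q" "d \<in> charts_at M (\<phi> q)"
    using y assms(1) c d by (rule overlapE)
  have qN: "q \<in> points N" by (rule charts_atD(3)[OF assms(1) q(3)])
  have param_rep: "param d (coord d (\<phi> q)) = \<phi> q"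
    by (rule param_coord[OF charts_atD(4,2)[OF assms(2) q(4)]])
  have T: "coord_vec N c i q \<in> tangent_space N q" for i
    by (rule coord_vec_in_tangent_space[OF assms(1) q(3)])
  have comp: "differential N M \<phi> q (coord_vec N c i q) d = local_deriv \<phi> c d q (axis i 1)" for i
    using differential_component[OF assms(1-3) qN T q(3,4)] tvec_of_self[OF assms(1) q(3)]
    by (simp add: coord_vec_eq_tvec_of)
  show ?thesis
    using tensor_expansion[OF assms(2,4) q(4) differential_in_tangent_space[OF assms(1-3) qN T]
        differential_in_tangent_space[OF assms(1-3) qN T], of i j]
    unfolding pullback_coeff_def comp
    by (simp only: o_apply param_rep q(2) tcoeff_def[of N] tensor_pullback_def q(1)[symmetric])
qed

lemma smooth_tensor_pullback:
  assumes "smooth_manifold N" "smooth_manifold M" "smooth_map N M \<phi>" "tensor_field02 M \<omega>"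
    and "smooth_tensor M \<omega>"
  shows "smooth_tensor N (tensor_pullback N M \<phi> \<omega>)"
  unfolding smooth_tensor_def
proof (intro ballI allI smooth_on_chart_if_smooth_on_overlaps[OF assms(1-3)])
  fix c d i j assume c: "c \<in> atlas N" and d: "d \<in> atlas M"
  have tc: "topological_chart (mtop N) c" using assms(1) c unfolding smooth_manifold_def by blast
  have o: "open (overlap \<phi> c d)" using assms(1-3) c d by (rule open_overlap)
  have "smooth_on (overlap \<phi> c d) (pullback_coeff (\<lambda>a b. tcoeff M \<omega> d a b \<circ> param d)
      (local_rep \<phi> c d) (axis i 1) (axis j 1))"
  proof (rule smooth_pullback_coeff[OF o smooth_local_rep[OF assms(3) c d]])
    show "local_rep \<phi> c d ` overlap \<phi> c d \<subseteq> coord d ` cdom d" using tc by (auto simp: param_coord)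
    show "smooth_on (coord d ` cdom d) (tcoeff M \<omega> d a b \<circ> param d)" for a b
      using assms(5) d unfolding smooth_tensor_def by blast
  qed
  then show "smooth_on (overlap \<phi> c d) (tcoeff N (tensor_pullback N M \<phi> \<omega>) c i j \<circ> param c)"
    by (rule smooth_on_cong[OF o, rotated]) (rule tcoeff_pullback[OF assms(1-4) c d, symmetric])
qed

lemma skew_tensor_pullback:
  assumes "smooth_manifold N" "smooth_manifold M" "smooth_map N M \<phi>" "skew_tensor M \<omega>"
  shows "skew_tensor N (tensor_pullback N M \<phi> \<omega>)"
  unfolding skew_tensor_def tensor_pullback_def
proof (intro ballI)
  fix q v w assume q: "q \<in> points N" and v: "v \<in> tangent_space N q" and w: "w \<in> tangent_space N q"
  have "\<phi> q \<in> points M" using q by (rule smooth_map_in_points[OF assms(3)])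
  then show "\<omega> (\<phi> q) (differential N M \<phi> q v) (differential N M \<phi> q w) =
    - \<omega> (\<phi> q) (differential N M \<phi> q w) (differential N M \<phi> q v)"
    using assms(4) differential_in_tangent_space[OF assms(1-3) q v]
      differential_in_tangent_space[OF assms(1-3) q w] unfolding skew_tensor_def by blast
qed

lemma closed_tensor_pullback:
  assumes "smooth_manifold N" "smooth_manifold M" "smooth_map N M \<phi>" "tensor_field02 M \<omega>"
    and "smooth_tensor M \<omega>" "skew_tensor M \<omega>" "closed_tensor M \<omega>"
  shows "closed_tensor N (tensor_pullback N M \<phi> \<omega>)"
  unfolding closed_tensor_def
proof (intro ballI allI)
  fix q c i j k assume q: "q \<in> points N" and c: "c \<in> charts_at N q"
  have \<phi>q: "\<phi> q \<in> points M" using q by (rule smooth_map_in_points[OF assms(3)])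
  obtain d where d: "d \<in> charts_at M (\<phi> q)" by (rule charts_at_nonempty[OF assms(2) \<phi>q])
  note C = charts_atD[OF assms(1) c] and D = charts_atD[OF assms(2) d]
  define F where "F = local_rep \<phi> c d"
  define W where "W = (\<lambda>a b. tcoeff M \<omega> d a b \<circ> param d)"
  have Fq: "F (coord c q) = coord d (\<phi> q)" using C by (simp add: F_def param_coord)
  have o: "open (overlap \<phi> c d)" using assms(1-3) C(1) D(1) by (rule open_overlap)
  have m: "coord c q \<in> overlap \<phi> c d" using c d by (rule mem_overlap)
  have F: "smooth_on (overlap \<phi> c d) F"
    unfolding F_def by (rule smooth_local_rep[OF assms(3) C(1) D(1)])
  have "smooth_on (coord d ` cdom d) (W a b)" for a b
    using assms(5) D(1) unfolding smooth_tensor_def W_def by blast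
  then have Ws: "W a b differentiable (at (F (coord c q)))" for a b
    unfolding Fq using D(2) by (intro smooth_on_differentiable[of "coord d ` cdom d"]) auto
  have dcoeff_eq: "dcoeff N (tensor_pullback N M \<phi> \<omega>) c k i j q =
      frechet_derivative (pullback_coeff W F (axis i 1) (axis j 1)) (at (coord c q)) (axis k 1)" for i j k
  proof -
    have "smooth_on (overlap \<phi> c d) (tcoeff N (tensor_pullback N M \<phi> \<omega>) c i j \<circ> param c)"
      using smooth_tensor_pullback[OF assms(1-5)] C(1) o
      by (intro smooth_on_subset[of "coord c ` cdom c" "overlap \<phi> c d"])
        (use C(4) in \<open>auto simp: topological_chart_def smooth_tensor_def\<close>)
    then have "frechet_derivative (tcoeff N (tensor_pullback N M \<phi> \<omega>) c i j \<circ> param c) (at (coord c q))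
        = frechet_derivative (pullback_coeff W F (axis i 1) (axis j 1)) (at (coord c q))"
      using tcoeff_pullback[OF assms(1-4) C(1) D(1)] m o unfolding W_def F_def
      by (intro frechet_derivative_transform_within_open[OF smooth_on_differentiable[of "overlap \<phi> c d"] o m])
    then show ?thesis by (simp add: dcoeff_def)
  qed
  show "dcoeff N (tensor_pullback N M \<phi> \<omega>) c i j k q + dcoeff N (tensor_pullback N M \<phi> \<omega>) c j k i q
      + dcoeff N (tensor_pullback N M \<phi> \<omega>) c k i j q = 0"
    unfolding dcoeff_eq
  proof (rule closed_pullback_coeff[OF o F m Ws])
    fix a b
    have "\<omega> (\<phi> q) (coord_vec M d a (\<phi> q)) (coord_vec M d b (\<phi> q)) =
        - \<omega> (\<phi> q) (coord_vec M d b (\<phi> q)) (coord_vec M d a (\<phi> q))"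
      using assms(6) \<phi>q coord_vec_in_tangent_space[OF assms(2) d] unfolding skew_tensor_def by blast
    then show "W a b (F (coord c q)) = - W b a (F (coord c q))"
      using D(2,4) by (simp add: Fq W_def param_coord tcoeff_def)
    fix e
    show "frechet_derivative (W b e) (at (F (coord c q))) (axis a 1)
      + frechet_derivative (W e a) (at (F (coord c q))) (axis b 1)
      + frechet_derivative (W a b) (at (F (coord c q))) (axis e 1) = 0"
      using assms(7) \<phi>q d unfolding closed_tensor_def dcoeff_def Fq W_def by blast
  qed
qed


section \<open>Symplectic manifold Galerkin reduction\<close>

text \<open>Applying \<open>sharp\<close> of the reduced form to both sides gives the reduced vector field on the left
  and the Hamiltonian vector field of \<open>H \<circ> \<phi>\<close> on the right.\<close>

lemma covec_pullback_flat_hamiltonian_vf: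
  assumes "smooth_manifold N" "hamiltonian_system M \<omega> H" "smooth_map N M \<phi>" "q \<in> points N"
  shows "covec_pullback N M \<phi> q (flat M \<omega> (\<phi> q) (hamiltonian_vf M \<omega> H (\<phi> q))) = dfun N (H \<circ> \<phi>) q"
proof -
  have M: "smooth_manifold M" "tensor_field02 M \<omega>" "nondegenerate M \<omega>" "smooth_function M H"
    using assms(2)
    by (auto simp: hamiltonian_system_def symplectic_manifold_def symplectic_form_def)
  have \<phi>q: "\<phi> q \<in> points M" by (rule smooth_map_in_points[OF assms(3,4)])
  have "flat M \<omega> (\<phi> q) (hamiltonian_vf M \<omega> H (\<phi> q)) = dfun M H (\<phi> q)"
    unfolding hamiltonian_vf_def
    using dfun_spec[OF M(1,4) \<phi>q] by (intro flat_sharp M(1-3) \<phi>q) blast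
  then show ?thesis using covec_pullback_dfun[OF assms(1) M(1) assms(3,4) M(4)] by simp
qed

lemma hamiltonian_system_pullback:
  assumes "hamiltonian_system M \<omega> H" "smooth_manifold N" "smooth_map N M \<phi>"
    and "nondegenerate N (tensor_pullback N M \<phi> \<omega>)"
  shows "hamiltonian_system N (tensor_pullback N M \<phi> \<omega>) (H \<circ> \<phi>)"
  using assms tensor_field02_pullback[of N M \<phi> \<omega>] smooth_tensor_pullback[of N M \<phi> \<omega>]
    skew_tensor_pullback[of N M \<phi> \<omega>] closed_tensor_pullback[of N M \<phi> \<omega>]
    smooth_function_compose[of N M \<phi> H]
  unfolding hamiltonian_system_def symplectic_manifold_def symplectic_form_def by blast

text \<open>A solution never leaves the manifold, so the two vector fields may differ outside of it, where
  neither of them has a meaning.\<close>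

lemma solves_ivp_cong:
  assumes "\<And>p. p \<in> points M \<Longrightarrow> X p = Y p"
  shows "solves_ivp M X t0 p0 I \<gamma> \<longleftrightarrow> solves_ivp M Y t0 p0 I \<gamma>"
proof -
  have "X (\<gamma> t) = Y (\<gamma> t)" if "continuous_map (top_of_set I) (mtop M) \<gamma>" "t \<in> I" for t
    using that continuous_map_image_subset_topspace by (intro assms) fastforce
  then show ?thesis unfolding solves_ivp_def by auto
qed

theorem theorem5p11:
  fixes M :: "('p, 'm::finite) manifold" and N :: "('q, 'n::finite) manifold"
    and \<omega> :: "('p, 'm) tensor02" and H :: "'p \<Rightarrow> real"
    and \<phi> :: "'q \<Rightarrow> 'p" and \<rho> :: "'p \<Rightarrow> 'q"
    and t0 :: real and \<gamma>0 :: 'p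
  assumes "hamiltonian_system M \<omega> H"
    and "\<gamma>0 \<in> points M"
    and "smooth_manifold N"
    and "smooth_embedding N M \<phi>"
    and "nondegenerate N (tensor_pullback N M \<phi> \<omega>)"
    and "point_reduction M N \<phi> \<rho>"
  shows "hamiltonian_system N (tensor_pullback N M \<phi> \<omega>) (H \<circ> \<phi>) \<and>
    \<rho> \<gamma>0 \<in> points N \<and>
    (\<forall>q\<in>points N. smg_reduction M \<omega> N \<phi> \<rho> (\<phi> q, hamiltonian_vf M \<omega> H (\<phi> q))
       = (q, hamiltonian_vf N (tensor_pullback N M \<phi> \<omega>) (H \<circ> \<phi>) q)) \<and>
    (\<forall>I \<gamma>. smg_rom M \<omega> H N \<phi> \<rho> t0 \<gamma>0 I \<gamma> \<longleftrightarrow>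
       hamiltonian_ivp N (tensor_pullback N M \<phi> \<omega>) (H \<circ> \<phi>) t0 (\<rho> \<gamma>0) I \<gamma>)"
proof -
  have \<phi>: "smooth_map N M \<phi>" using assms(4) by (simp add: smooth_embedding_def)
  have \<rho>: "smooth_map M N \<rho>" "\<And>q. q \<in> points N \<Longrightarrow> \<rho> (\<phi> q) = q"
    using assms(6) by (auto simp: point_reduction_def)
  have red: "smg_reduction M \<omega> N \<phi> \<rho> (\<phi> q, hamiltonian_vf M \<omega> H (\<phi> q))
       = (q, hamiltonian_vf N (tensor_pullback N M \<phi> \<omega>) (H \<circ> \<phi>) q)" if q: "q \<in> points N" for q
    using covec_pullback_flat_hamiltonian_vf[OF assms(3,1) \<phi> q] \<rho>(2)[OF q]
    by (simp add: smg_reduction_def smg_reduction_at_def hamiltonian_vf_def[of N])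
  have "smg_vf M \<omega> H N \<phi> \<rho> q = hamiltonian_vf N (tensor_pullback N M \<phi> \<omega>) (H \<circ> \<phi>) q"
    if "q \<in> points N" for q
    using red[OF that] by (simp add: smg_vf_def)
  then have "smg_rom M \<omega> H N \<phi> \<rho> t0 \<gamma>0 I \<gamma> \<longleftrightarrow>
      hamiltonian_ivp N (tensor_pullback N M \<phi> \<omega>) (H \<circ> \<phi>) t0 (\<rho> \<gamma>0) I \<gamma>" for I \<gamma>
    unfolding smg_rom_def hamiltonian_ivp_def by (rule solves_ivp_cong)
  moreover have "\<rho> \<gamma>0 \<in> points N"
    by (rule smooth_map_in_points[OF \<rho>(1) assms(2)])
  ultimately show ?thesis
    using hamiltonian_system_pullback[OF assms(1,3) \<phi> assms(5)] red by blast
qed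

end
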